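(* Let $K$ be a field and let $\Lambda$ be the incidence complex of a projective plane of order $q$. Then, for each integer $i\ge 1$, $$\beta_i(K[\Lambda])=\beta_{i,i+2}(K[\Lambda])=(q^2+q+1)\binom{q^2}{i+2}+q^3\binom{q^2+q}{i+1}-q(q+1)\binom{q^2+q}{i+2}.$$ In particular, $\beta_{q^2+q-1}(K[\Lambda])=q^3$.
   Context: A linear space $(P,L)$ consists of a finite set $P$ of points and a finite set $L$ of lines (identified with their sets of incident points) such that any two distinct points lie on exactly one common line and every line contains at least two points. A finite projective plane is a linear space such that any two distinct lines meet in exactly one point, there exist three noncollinear points, and every line contains at least three points. It has order $q$ if $\#P=\#L=q^2+q+1$, every point lies on exactly $q+1$ lines, and every line contains exactly $q+1$ points (every finite projective plane has an order in this sense). The incidence complex $\Lambda$ of $(P,L)$ is the simplicial complex on $P$ whose facets are the sets of points on each line. With $d=\#P$ and $R=K[x_1,\dots,x_d]$ (standard grading, variables indexed by the points), $K[\Lambda]=R/I_\Lambda$ is the Stanley-Reisner ring, where $I_\Lambda$ is generated by the squarefree monomials corresponding to nonfaces. $\beta_{i,j}(M)=\dim_K[\operatorname{Tor}_i^R(K,M)]_j$ and $\beta_i(M)=\dim_K\operatorname{Tor}_i^R(K,M)$. Binomial coefficients $\binom{a}{b}$ with $a\ge0$ are $0$ if $b<0$ or $b>a$. *)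

theory Defs
  imports Complex_Main "HOL-Library.Poly_Mapping"
begin

section \<open>Projective planes\<close>

definition linear_space :: "'p set \<Rightarrow> 'p set set \<Rightarrow> bool" where
  "linear_space P L \<longleftrightarrow>
     finite P \<and> finite L \<and> (\<forall>l\<in>L. l \<subseteq> P) \<and>
     (\<forall>x\<in>P. \<forall>y\<in>P. x \<noteq> y \<longrightarrow> (\<exists>!l. l \<in> L \<and> x \<in> l \<and> y \<in> l)) \<and>
     (\<forall>l\<in>L. card l \<ge> 2)"

definition projective_plane :: "'p set \<Rightarrow> 'p set set \<Rightarrow> bool" where
  "projective_plane P L \<longleftrightarrow>
     linear_space P L \<and>
     (\<forall>l\<in>L. \<forall>m\<in>L. l \<noteq> m \<longrightarrow> (\<exists>!x. x \<in> l \<and> x \<in> m)) \<and>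
     (\<exists>x\<in>P. \<exists>y\<in>P. \<exists>z\<in>P. x \<noteq> y \<and> y \<noteq> z \<and> x \<noteq> z \<and> \<not> (\<exists>l\<in>L. {x, y, z} \<subseteq> l)) \<and>
     (\<forall>l\<in>L. card l \<ge> 3)"

definition has_order :: "'p set \<Rightarrow> 'p set set \<Rightarrow> nat \<Rightarrow> bool" where
  "has_order P L q \<longleftrightarrow>
     card P = q\<^sup>2 + q + 1 \<and> card L = q\<^sup>2 + q + 1 \<and>
     (\<forall>x\<in>P. card {l \<in> L. x \<in> l} = q + 1) \<and> (\<forall>l\<in>L. card l = q + 1)"

definition incidence_complex :: "'p set set \<Rightarrow> 'p set set" where
  "incidence_complex L = {\<sigma>. \<exists>l\<in>L. \<sigma> \<subseteq> l}"


section \<open>Stanley-Reisner ideals\<close>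

text \<open>The polynomial ring over \<open>'k\<close> in variables indexed by the finite type \<open>'p\<close>;
  monomials are exponent vectors.\<close>

type_synonym ('p, 'k) polyring = "('p \<Rightarrow>\<^sub>0 nat) \<Rightarrow>\<^sub>0 'k"

definition var :: "'p \<Rightarrow> ('p, 'k::field) polyring" where
  "var p = Poly_Mapping.single (Poly_Mapping.single p 1) 1"

definition stanley_reisner_ideal :: "'p::finite set set \<Rightarrow> ('p, 'k::field) polyring set" where
  "stanley_reisner_ideal \<Delta> = module.span (*) {\<Prod>p\<in>\<sigma>. var p | \<sigma>. \<sigma> \<notin> \<Delta>}"

definition total_degree :: "('p::finite \<Rightarrow>\<^sub>0 nat) \<Rightarrow> nat" where
  "total_degree m = (\<Sum>p\<in>UNIV. Poly_Mapping.lookup m p)"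


section \<open>Graded free modules and graded free resolutions of the residue field\<close>

text \<open>The free module on a basis \<open>S\<close> of natural numbers consists of the vectors in
  \<open>nat \<Rightarrow>\<^sub>0 R\<close> supported on \<open>S\<close>. Any linear map between free modules on such bases extends
  (by \<open>0\<close> on the other basis vectors) to all of \<open>nat \<Rightarrow>\<^sub>0 R\<close>, so linear maps are taken
  to be defined there.\<close>

type_synonym ('p, 'k) free = "nat \<Rightarrow>\<^sub>0 ('p, 'k) polyring"

definition free_on :: "nat set \<Rightarrow> ('p, 'k::field) free set" where
  "free_on S = {f. Poly_Mapping.keys f \<subseteq> S}"

definition rscale :: "('p, 'k::field) polyring \<Rightarrow> ('p, 'k) free \<Rightarrow> ('p, 'k) free" where
  "rscale r f = Poly_Mapping.map ((*) r) f"

definition kscale :: "'k::field \<Rightarrow> ('p, 'k) free \<Rightarrow> ('p, 'k) free" where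
  "kscale c f = rscale (Poly_Mapping.single 0 c) f"

text \<open>The action of \<open>R\<close> on the residue field \<open>K = R/(x\<^sub>1,\<dots>,x\<^sub>d)\<close>, through the constant term.\<close>

definition residue_scale :: "('p, 'k::field) polyring \<Rightarrow> 'k \<Rightarrow> 'k" where
  "residue_scale r c = Poly_Mapping.lookup r 0 * c"

text \<open>The homogeneous elements of degree \<open>j\<close> (including \<open>0\<close>), when the basis vector \<open>b\<close>
  has degree \<open>\<delta> b\<close>.\<close>

definition homogeneous :: "(nat \<Rightarrow> nat) \<Rightarrow> nat \<Rightarrow> ('p::finite, 'k::field) free set" where
  "homogeneous \<delta> j = {f. \<forall>b. \<forall>m \<in> Poly_Mapping.keys (Poly_Mapping.lookup f b). total_degree m + \<delta> b = j}"

text \<open>Data of a complex \<open>\<dots> \<rightarrow> F\<^sub>2 \<rightarrow> F\<^sub>1 \<rightarrow> F\<^sub>0 \<rightarrow> K\<close>: \<open>F\<^sub>i\<close> is free on \<open>gens F i\<close>, the basis vector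
  \<open>b\<close> of \<open>F\<^sub>i\<close> has degree \<open>gdeg F i b\<close>, \<open>diff F i\<close> is the differential out of \<open>F\<^sub>i\<close> (zero for
  \<open>i = 0\<close>), and \<open>aug F\<close> is the augmentation.\<close>

record (overloaded) ('p, 'k) aug_complex =
  gens :: "nat \<Rightarrow> nat set"
  gdeg :: "nat \<Rightarrow> nat \<Rightarrow> nat"
  diff :: "nat \<Rightarrow> ('p, 'k) free \<Rightarrow> ('p, 'k) free"
  aug :: "('p, 'k) free \<Rightarrow> 'k"

definition graded_free_resolution :: "('p::finite, 'k::field) aug_complex \<Rightarrow> bool" where
  "graded_free_resolution F \<longleftrightarrow>
     (\<forall>i. module_hom rscale rscale (diff F i)) \<and>
     diff F 0 = (\<lambda>_. 0) \<and>
     (\<forall>i. diff F (Suc i) ` free_on (gens F (Suc i)) \<subseteq> free_on (gens F i)) \<and>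
     (\<forall>i j. diff F (Suc i) ` (free_on (gens F (Suc i)) \<inter> homogeneous (gdeg F (Suc i)) j)
              \<subseteq> homogeneous (gdeg F i) j) \<and>
     module_hom rscale residue_scale (aug F) \<and>
     aug F ` free_on (gens F 0) = UNIV \<and>
     (\<forall>j. j \<noteq> 0 \<longrightarrow> aug F ` (free_on (gens F 0) \<inter> homogeneous (gdeg F 0) j) \<subseteq> {0}) \<and>
     {f \<in> free_on (gens F 0). aug F f = 0} = diff F 1 ` free_on (gens F 1) \<and>
     (\<forall>i\<ge>1. {f \<in> free_on (gens F i). diff F i f = 0} = diff F (Suc i) ` free_on (gens F (Suc i)))"


section \<open>Tor and Betti numbers\<close>

text \<open>For \<open>K\<close>-subspaces \<open>B \<subseteq> Z\<close>, the set \<open>C\<close> maps bijectively to a basis of \<open>Z/B\<close>; the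
  dimension of \<open>Z/B\<close> is the cardinality of such a set (\<open>0\<close> if it is infinite, as for
  \<open>vector_space.dim\<close>).\<close>

definition basis_modulo ::
    "('p, 'k::field) free set \<Rightarrow> ('p, 'k) free set \<Rightarrow> ('p, 'k) free set \<Rightarrow> bool" where
  "basis_modulo Z B C \<longleftrightarrow>
     C \<subseteq> Z \<and> Z \<subseteq> module.span kscale (B \<union> C) \<and>
     (\<forall>c\<in>C. c \<notin> module.span kscale (B \<union> (C - {c})))"

definition quotient_dim :: "('p, 'k::field) free set \<Rightarrow> ('p, 'k) free set \<Rightarrow> nat" where
  "quotient_dim Z B = card (SOME C. basis_modulo Z B C)"

text \<open>For an ideal \<open>I\<close>, the complex \<open>F \<otimes> R/I\<close> is \<open>F/IF\<close>, where \<open>I\<cdot>F\<^sub>i\<close> consists of the vectors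
  in \<open>F\<^sub>i\<close> with all coordinates in \<open>I\<close>. The following are the preimages in \<open>F\<^sub>i\<close> of its
  cycles and boundaries, so that \<open>Tor\<^sub>i(K, R/I) = tor_cycles F I i / tor_boundaries F I i\<close>
  for any graded free resolution \<open>F\<close> of \<open>K\<close>.\<close>

definition ideal_times_free :: "('p, 'k::field) polyring set \<Rightarrow> nat set \<Rightarrow> ('p, 'k) free set" where
  "ideal_times_free I S = {f \<in> free_on S. \<forall>b. Poly_Mapping.lookup f b \<in> I}"

definition tor_cycles ::
    "('p::finite, 'k::field) aug_complex \<Rightarrow> ('p, 'k) polyring set \<Rightarrow> nat \<Rightarrow> ('p, 'k) free set" where
  "tor_cycles F I i =
     {f \<in> free_on (gens F i). \<forall>b. Poly_Mapping.lookup (diff F i f) b \<in> I}"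

definition tor_boundaries ::
    "('p::finite, 'k::field) aug_complex \<Rightarrow> ('p, 'k) polyring set \<Rightarrow> nat \<Rightarrow> ('p, 'k) free set" where
  "tor_boundaries F I i =
     {diff F (Suc i) g + h | g h. g \<in> free_on (gens F (Suc i)) \<and> h \<in> ideal_times_free I (gens F i)}"

definition chosen_resolution :: "('p::finite, 'k::field) aug_complex" where
  "chosen_resolution = (SOME F. graded_free_resolution F)"

text \<open>\<open>betti I i\<close> is \<open>\<beta>\<^sub>i(R/I)\<close>. For the bigraded \<open>\<beta>\<^sub>i\<^sub>,\<^sub>j(R/I)\<close>, the ideal \<open>I\<close> is understood to be
  homogeneous, so that cycles and boundaries are graded subspaces and the degree \<open>j\<close> part
  of the quotient is the quotient of the degree \<open>j\<close> parts.\<close>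

definition betti :: "('p::finite, 'k::field) polyring set \<Rightarrow> nat \<Rightarrow> nat" where
  "betti I i =
     (let F = chosen_resolution in quotient_dim (tor_cycles F I i) (tor_boundaries F I i))"

definition graded_betti :: "('p::finite, 'k::field) polyring set \<Rightarrow> nat \<Rightarrow> nat \<Rightarrow> nat" where
  "graded_betti I i j =
     (let F = chosen_resolution; H = homogeneous (gdeg F i) j
      in quotient_dim (tor_cycles F I i \<inter> H) (tor_boundaries F I i \<inter> H))"

lemma lookup_rscale [simp]:
  "Poly_Mapping.lookup (rscale r f) b = r * Poly_Mapping.lookup f b"
  by (simp add: rscale_def Poly_Mapping.map.rep_eq when_def)

lemma module_rscale: "module rscale"
  by unfold_locales (auto intro!: poly_mapping_eqI simp: lookup_add algebra_simps)

lemma vector_space_kscale: "vector_space (kscale :: 'k::field \<Rightarrow> ('p, 'k) free \<Rightarrow> _)"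
proof -
  have 1: "Poly_Mapping.single (0::'p \<Rightarrow>\<^sub>0 nat) (1::'k) = 1"
    by (rule poly_mapping_eqI) (simp add: lookup_single lookup_one when_def)
  show ?thesis
    by unfold_locales
       (auto intro!: poly_mapping_eqI
             simp: kscale_def lookup_add single_add mult_single 1 algebra_simps
             simp flip: mult.assoc)
qed

end

theory Submission
  imports Defs
begin

text \<open>
  The Betti numbers of \<open>K[\<Lambda>]\<close> are Tor dimensions, computed here from the Koszul complex. That complex is
  a direct sum over multidegrees \<open>a\<close>; in multidegree \<open>a\<close> it is the augmented chain complex of
  the simplex on the support of \<open>a\<close>. After tensoring with \<open>K[\<Lambda>]\<close> only those coefficients at
  \<open>\<sigma>\<close> remain for which the support of \<open>a - \<sigma>\<close> is a face of \<open>\<Lambda>\<close>. When \<open>a\<close> is squarefree with support \<open>W\<close>, passing from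
  \<open>\<sigma>\<close> to \<open>W - \<sigma>\<close> identifies the result with the augmented cochain complex of the restriction of \<open>\<Lambda>\<close> to \<open>W\<close>, as
  in Hochster's formula.

  The restriction of \<open>\<Lambda>\<close> to \<open>W\<close> is a union of simplices \<open>l \<inter> W\<close> that meet pairwise in at most one point, and any two
  points lie in one of them. So it is connected, and contracting each line separately shows that there
  is no cohomology above degree one. A multidegree that is not squarefree contributes nothing, since
  a repeated variable allows a contraction. All these contractions are one computation, the
  cone construction in \<open>simplex_boundary_cone\<close>, with different choices of the apex. What remains is
  the first cohomology, which sits in homological degree \<open>i\<close> and internal degree \<open>i + 2\<close>; this is why
  \<open>\<beta>\<^sub>i = \<beta>\<^bsub>i,i+2\<^esub>\<close>.

  First cohomology is determined by an explicit basis. A \<open>1\<close>-cocycle is on every line the coboundary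
  of a function, so line by line it has \<open>card (l \<inter> W) - 1\<close> degrees of freedom; global coboundaries can be
  used to make it vanish on all lines through one fixed vertex \<open>w\<close> of \<open>W\<close>. The functionals dual to the
  resulting basis are the values of the coboundary on the nonface triangles \<open>{w, x, y}\<close>, with \<open>x\<close> a base
  point of the line: they vanish on coboundaries by \<open>triangle_value_boundary\<close>, and by
  \<open>triangle_values_detect_boundaries\<close> a cocycle on which all of them vanish is a coboundary. The dimension is the
  sum of \<open>card (l \<inter> W) - 1\<close> over the lines that meet \<open>W\<close> and avoid \<open>w\<close>, and double counting over
  all \<open>W\<close> of size \<open>i + 2\<close> gives the formula.

  Betti numbers are defined through an unspecified graded free resolution of \<open>K\<close>. The Koszul
  complex is one (\<open>koszul_resolution\<close>), and the comparison theorem in the form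
  \<open>tor_dual_system_transfer\<close> carries the basis and the dual functionals from the Koszul complex to any other
  graded free resolution, total and degreewise Tor alike.
\<close>

section \<open>Dimensions of quotients\<close>

interpretation kvs: vector_space "kscale :: 'k::field \<Rightarrow> ('p, 'k) free \<Rightarrow> ('p, 'k) free"
  by (rule vector_space_kscale)

interpretation rmod: module "rscale :: ('p, 'k::field) polyring \<Rightarrow> ('p, 'k) free \<Rightarrow> ('p, 'k) free"
  by (rule module_rscale)

interpretation ideals: module "(*) :: ('p, 'k::field) polyring \<Rightarrow> _"
  by unfold_locales (simp_all add: algebra_simps)

text \<open>Such data exhibit the vectors \<open>b t\<close> as a basis of \<open>Z\<close> modulo \<open>B\<close>, together with the dual basis of
  functionals. Dimensions of Tor modules are computed by giving a dual system: it needs no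
  choice of complements, and it can be carried from one resolution to another.\<close>

definition dual_system ::
    "('p, 'k::field) free set \<Rightarrow> ('p, 'k) free set \<Rightarrow> ('t \<Rightarrow> ('p, 'k) free)
      \<Rightarrow> ('t \<Rightarrow> ('p, 'k) free \<Rightarrow> 'k) \<Rightarrow> 't set \<Rightarrow> bool" where
  "dual_system Z B b \<phi> J \<longleftrightarrow>
     module.subspace kscale Z \<and> module.subspace kscale B \<and> finite J \<and>
     (\<forall>t\<in>J. b t \<in> Z) \<and> (\<forall>t\<in>J. module_hom kscale (*) (\<phi> t)) \<and>
     (\<forall>s\<in>J. \<forall>t\<in>J. \<phi> t (b s) = (if s = t then 1 else 0)) \<and>
     (\<forall>t\<in>J. \<forall>z\<in>B. \<phi> t z = 0) \<and>
     (\<forall>z\<in>Z. (\<forall>t\<in>J. \<phi> t z = 0) \<longrightarrow> z \<in> B)"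

text \<open>The operator \<open>P z = (\<Sum>t\<in>J. \<phi> t z \<cdot> b t)\<close> is a projection of the whole space onto the span of the \<open>b t\<close>
  that kills \<open>B\<close> and satisfies \<open>z - P z \<in> B\<close> for \<open>z \<in> Z\<close>. It therefore maps any set that is a basis of \<open>Z\<close>
  modulo \<open>B\<close> bijectively to an ordinary basis of this span, and all bases of the span have
  \<open>card J\<close> elements; this makes the choice in the definition of the quotient dimension harmless.\<close>

lemma quotient_dim_dual_system:
  assumes "dual_system Z B b \<phi> J"
  shows "quotient_dim Z B = card J"
proof -
  have Z: "kvs.subspace Z" and B: "kvs.subspace B" and J: "finite J"
    and bZ: "\<And>t. t \<in> J \<Longrightarrow> b t \<in> Z"
    and hom: "\<And>t. t \<in> J \<Longrightarrow> module_hom kscale (*) (\<phi> t)"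
    and dual: "\<And>s t. s \<in> J \<Longrightarrow> t \<in> J \<Longrightarrow> \<phi> t (b s) = (if s = t then 1 else 0)"
    and van: "\<And>t z. t \<in> J \<Longrightarrow> z \<in> B \<Longrightarrow> \<phi> t z = 0"
    and ker: "\<And>z. z \<in> Z \<Longrightarrow> (\<And>t. t \<in> J \<Longrightarrow> \<phi> t z = 0) \<Longrightarrow> z \<in> B"
    using assms unfolding dual_system_def by auto
  note hadd = module_hom.add[OF hom] and hscale = module_hom.scale[OF hom]
    and hdiff = module_hom.diff[OF hom] and hsum = module_hom.sum[OF hom]
  define P where "P z = (\<Sum>t\<in>J. kscale (\<phi> t z) (b t))" for z
  have Phom: "module_hom kscale kscale P"
    by unfold_locales
      (simp_all add: P_def hadd hscale kvs.scale_left_distrib sum.distrib kvs.scale_sum_right)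
  have \<phi>P: "\<phi> t (P z) = \<phi> t z" if "t \<in> J" for t z
    using that J by (simp add: P_def hsum hscale dual if_distrib[of "\<lambda>x. _ * x"] cong: if_cong)
  have Pb: "P (b s) = b s" if "s \<in> J" for s
  proof -
    have "P (b s) = (\<Sum>t\<in>J. if t = s then b t else 0)"
      unfolding P_def by (rule sum.cong) (use that in \<open>auto simp: dual\<close>)
    then show ?thesis using that J by simp
  qed
  have PB: "P z = 0" if "z \<in> B" for z
    using that by (simp add: P_def van)
  have PZ: "P z \<in> Z" for z
    unfolding P_def using Z bZ by (intro kvs.subspace_sum kvs.subspace_scale) auto
  have Psp: "P z \<in> kvs.span (b ` J)" for z
    unfolding P_def by (intro kvs.span_sum kvs.span_scale kvs.span_base) auto
  have res: "z - P z \<in> B" if "z \<in> Z" for z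
    using that PZ Z by (intro ker kvs.subspace_diff) (auto simp: hdiff \<phi>P)
  have inj: "inj_on b J"
    by (rule inj_onI) (metis dual zero_neq_one)
  have indb: "kvs.independent (b ` J)"
  proof (rule kvs.independent_if_scalars_zero)
    show "finite (b ` J)" using J by simp
    fix f x assume f: "(\<Sum>x\<in>b ` J. kscale (f x) x) = 0" and "x \<in> b ` J"
    then obtain t where t: "t \<in> J" "x = b t" by auto
    have "0 = \<phi> t (\<Sum>s\<in>J. kscale (f (b s)) (b s))"
      using f t module_hom.zero[OF hom] by (simp add: sum.reindex[OF inj] o_def)
    also have "\<dots> = (\<Sum>s\<in>J. if s = t then f (b s) else 0)"
      by (simp add: hsum[OF t(1)] hscale[OF t(1)], rule sum.cong) (use t in \<open>auto simp: dual\<close>)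
    also have "\<dots> = f x" using t J by simp
    finally show "f x = 0" by simp
  qed
  have bas: "basis_modulo Z B (b ` J)"
    unfolding basis_modulo_def
  proof (intro conjI ballI subsetI)
    show "z \<in> Z" if "z \<in> b ` J" for z using that bZ by auto
    show "z \<in> kvs.span (B \<union> b ` J)" if "z \<in> Z" for z
    proof -
      have "z - P z \<in> kvs.span (B \<union> b ` J)" using res[OF that] by (intro kvs.span_base) auto
      moreover have "P z \<in> kvs.span (B \<union> b ` J)" using Psp kvs.span_mono[of "b ` J" "B \<union> b ` J"] by auto
      ultimately have "(z - P z) + P z \<in> kvs.span (B \<union> b ` J)" by (rule kvs.span_add)
      then show ?thesis by simp
    qed
    show "c \<notin> kvs.span (B \<union> (b ` J - {c}))" if "c \<in> b ` J" for c
    proof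
      assume *: "c \<in> kvs.span (B \<union> (b ` J - {c}))"
      from that obtain t where t: "t \<in> J" "c = b t" by auto
      have "kvs.span (B \<union> (b ` J - {c})) \<subseteq> {v. \<phi> t v = 0}"
        by (rule kvs.span_minimal) (use t van dual module_hom.subspace_kernel[OF hom] in auto)
      then show False using * t dual by auto
    qed
  qed
  have "card C = card J" if "basis_modulo Z B C" for C
  proof -
    have C: "C \<subseteq> Z" "Z \<subseteq> kvs.span (B \<union> C)" "\<And>c. c \<in> C \<Longrightarrow> c \<notin> kvs.span (B \<union> (C - {c}))"
      using that unfolding basis_modulo_def by auto
    have nonrel: "P c \<noteq> P v" if "c \<in> C" "v \<in> kvs.span (C - {c})" for c v
    proof
      assume eq: "P c = P v"
      have "kvs.span (C - {c}) \<subseteq> Z" using C(1) Z by (intro kvs.span_minimal) auto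
      then have "c - v \<in> Z" using that C(1) Z by (intro kvs.subspace_diff) auto
      from res[OF this] have "c - v \<in> B" using eq by (simp add: module_hom.diff[OF Phom])
      then have "c - v \<in> kvs.span (B \<union> (C - {c}))" by (intro kvs.span_base) auto
      moreover have "v \<in> kvs.span (B \<union> (C - {c}))"
        using that(2) kvs.span_mono[of "C - {c}" "B \<union> (C - {c})"] by auto
      ultimately have "(c - v) + v \<in> kvs.span (B \<union> (C - {c}))" by (rule kvs.span_add)
      with C(3)[OF that(1)] show False by simp
    qed
    have injP: "inj_on P C"
      by (rule inj_onI) (metis nonrel kvs.span_base insertE insert_Diff)
    have indP: "kvs.independent (P ` C)"
      unfolding kvs.dependent_def
    proof safe
      fix c assume c: "c \<in> C" and "P c \<in> kvs.span (P ` C - {P c})"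
      moreover have "P ` C - {P c} = P ` (C - {c})" using injP c by (auto simp: inj_on_def)
      ultimately have "P c \<in> P ` kvs.span (C - {c})"
        using module_hom.span_image[OF Phom] by metis
      then show False using nonrel[OF c] by auto
    qed
    have "kvs.span (P ` C) = kvs.span (b ` J)"
    proof
      show "kvs.span (P ` C) \<subseteq> kvs.span (b ` J)"
        by (rule kvs.span_minimal) (use Psp in auto)
      have "b t \<in> kvs.span (P ` C)" if "t \<in> J" for t
      proof -
        have "P (b t) \<in> P ` kvs.span (B \<union> C)" using C(2) bZ[OF that] by auto
        then have "b t \<in> kvs.span (P ` (B \<union> C))"
          using Pb[OF that] module_hom.span_image[OF Phom] by metis
        moreover have "kvs.span (P ` (B \<union> C)) \<subseteq> kvs.span (P ` C)"
          by (rule kvs.span_minimal) (auto simp: PB kvs.span_zero intro: kvs.span_base)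
        ultimately show ?thesis by auto
      qed
      then show "kvs.span (b ` J) \<subseteq> kvs.span (P ` C)"
        by (intro kvs.span_minimal) auto
    qed
    then have "card (P ` C) = card (b ` J)"
      using kvs.dim_eq_card[OF _ indP] kvs.dim_eq_card[OF _ indb] by metis
    then show ?thesis using card_image[OF injP] card_image[OF inj] by simp
  qed
  then show ?thesis
    unfolding quotient_dim_def using bas by (metis someI_ex)
qed

text \<open>Linear maps that are mutually inverse on the quotients push forward the basis and pull back the
  functionals.\<close>

lemma dual_system_transfer:
  assumes D: "dual_system Z B b \<phi> J"
    and Z': "module.subspace kscale Z'" and B': "module.subspace kscale B'"
    and f: "module_hom kscale kscale f" and g: "module_hom kscale kscale g"
    and fZ: "\<And>z. z \<in> Z \<Longrightarrow> f z \<in> Z'" and fB: "\<And>z. z \<in> B \<Longrightarrow> f z \<in> B'"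
    and gZ: "\<And>z. z \<in> Z' \<Longrightarrow> g z \<in> Z" and gB: "\<And>z. z \<in> B' \<Longrightarrow> g z \<in> B"
    and gf: "\<And>z. z \<in> Z \<Longrightarrow> g (f z) - z \<in> B" and fg: "\<And>z. z \<in> Z' \<Longrightarrow> f (g z) - z \<in> B'"
  shows "dual_system Z' B' (f \<circ> b) (\<lambda>t. \<phi> t \<circ> g) J"
proof -
  have J: "finite J"
    and bZ: "\<And>t. t \<in> J \<Longrightarrow> b t \<in> Z"
    and hom: "\<And>t. t \<in> J \<Longrightarrow> module_hom kscale (*) (\<phi> t)"
    and dual: "\<And>s t. s \<in> J \<Longrightarrow> t \<in> J \<Longrightarrow> \<phi> t (b s) = (if s = t then 1 else 0)"
    and van: "\<And>t z. t \<in> J \<Longrightarrow> z \<in> B \<Longrightarrow> \<phi> t z = 0"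
    and ker: "\<And>z. z \<in> Z \<Longrightarrow> (\<And>t. t \<in> J \<Longrightarrow> \<phi> t z = 0) \<Longrightarrow> z \<in> B"
    using D unfolding dual_system_def by auto
  have "\<phi> t (g (f (b s))) = \<phi> t (b s)" if "s \<in> J" "t \<in> J" for s t
    using van[OF that(2) gf[OF bZ[OF that(1)]]] by (simp add: module_hom.diff[OF hom[OF that(2)]])
  moreover have "z \<in> B'" if z: "z \<in> Z'" and "\<And>t. t \<in> J \<Longrightarrow> \<phi> t (g z) = 0" for z
  proof -
    have "f (g z) \<in> B'" using that gZ ker fB by blast
    then have "f (g z) - (f (g z) - z) \<in> B'" using fg[OF z] B' by (rule kvs.subspace_diff[rotated])
    then show ?thesis by simp
  qed
  ultimately show ?thesis
    unfolding dual_system_def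
    using J Z' B' bZ fZ gB van dual module_hom_compose[OF g hom] by (auto simp: o_def)
qed

section \<open>Graded maps between free modules\<close>

abbreviation bvec :: "nat \<Rightarrow> ('p, 'k::field) free" where
  "bvec b \<equiv> Poly_Mapping.single b 1"

lemma module_hom_kscale:
  "module_hom rscale rscale h \<Longrightarrow> module_hom kscale kscale h"
  unfolding module_hom_iff by (auto simp: kvs.module_axioms kscale_def)

lemma subspace_kscale:
  "module.subspace rscale S \<Longrightarrow> module.subspace kscale S"
  by (auto simp: rmod.subspace_def kvs.subspace_def kscale_def)

lemma subspace_free_on: "module.subspace rscale (free_on S)"
proof -
  have "free_on S = {f. \<forall>b. b \<notin> S \<longrightarrow> Poly_Mapping.lookup f b = 0}"
    unfolding free_on_def by (auto simp: in_keys_iff)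
  then show ?thesis by (auto simp: rmod.subspace_def lookup_add)
qed

lemma free_expand:
  assumes "finite A" "Poly_Mapping.keys f \<subseteq> A"
  shows "f = (\<Sum>b\<in>A. rscale (Poly_Mapping.lookup f b) (bvec b))"
proof (rule poly_mapping_eqI)
  fix c
  have "(\<Sum>b\<in>A. Poly_Mapping.lookup f b * Poly_Mapping.lookup (bvec b) c) =
        (\<Sum>b\<in>A. if b = c then Poly_Mapping.lookup f c else 0)"
    by (rule sum.cong) (auto simp: lookup_single)
  then show "Poly_Mapping.lookup f c =
      Poly_Mapping.lookup (\<Sum>b\<in>A. rscale (Poly_Mapping.lookup f b) (bvec b)) c"
    using assms by (auto simp: lookup_sum in_keys_iff)
qed

text \<open>The equation determines a linear map by its values on the basis vectors. The target is any module,
  so the lemma covers the augmentation as well as maps between free modules.\<close>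

lemma module_hom_expand:
  assumes "module_hom rscale s h"
  shows "h f = (\<Sum>b\<in>Poly_Mapping.keys f. s (Poly_Mapping.lookup f b) (h (bvec b)))"
proof -
  have "h f = h (\<Sum>b\<in>Poly_Mapping.keys f. rscale (Poly_Mapping.lookup f b) (bvec b))"
    using free_expand[of "Poly_Mapping.keys f" f] by simp
  then show ?thesis by (simp add: module_hom.sum[OF assms] module_hom.scale[OF assms])
qed

lemma module_hom_eq_on_free:
  assumes "module_hom rscale s g" "module_hom rscale s h"
    and "\<And>b. b \<in> S \<Longrightarrow> g (bvec b) = h (bvec b)" and "f \<in> free_on S"
  shows "g f = h f"
  unfolding module_hom_expand[OF assms(1), of f] module_hom_expand[OF assms(2), of f]
  by (rule sum.cong) (use assms(3,4) in \<open>auto simp: free_on_def\<close>)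

definition basis_extend :: "(nat \<Rightarrow> ('p, 'k::field) free) \<Rightarrow> ('p, 'k) free \<Rightarrow> ('p, 'k) free" where
  "basis_extend y f = (\<Sum>b\<in>Poly_Mapping.keys f. rscale (Poly_Mapping.lookup f b) (y b))"

lemma basis_extend_superset:
  assumes "finite A" "Poly_Mapping.keys f \<subseteq> A"
  shows "basis_extend y f = (\<Sum>b\<in>A. rscale (Poly_Mapping.lookup f b) (y b))"
  unfolding basis_extend_def
  by (rule sum.mono_neutral_left) (use assms in \<open>auto simp: in_keys_iff\<close>)

lemma basis_extend_bvec [simp]: "basis_extend y (bvec b) = y b"
  by (simp add: basis_extend_def)

lemma module_hom_basis_extend: "module_hom rscale rscale (basis_extend y)"
proof unfold_locales
  fix f g :: "('a, 'b) free" and r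
  let ?A = "Poly_Mapping.keys f \<union> Poly_Mapping.keys g"
  have "Poly_Mapping.keys (f + g) \<subseteq> ?A" by (rule keys_add)
  then show "basis_extend y (f + g) = basis_extend y f + basis_extend y g"
    by (simp add: basis_extend_superset[of ?A] lookup_add rmod.scale_left_distrib sum.distrib)
  have "Poly_Mapping.keys (rscale r f) \<subseteq> Poly_Mapping.keys f" by (auto simp: in_keys_iff)
  then show "basis_extend y (rscale r f) = rscale r (basis_extend y f)"
    by (simp add: basis_extend_superset[of "Poly_Mapping.keys f"] rmod.scale_sum_right)
qed

lemma total_degree_add [simp]: "total_degree (m + n) = total_degree m + total_degree n"
  by (simp add: total_degree_def lookup_add sum.distrib)

lemma total_degree_0 [simp]: "total_degree 0 = 0"
  by (simp add: total_degree_def)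

lemma homogeneousD:
  "f \<in> homogeneous \<delta> j \<Longrightarrow> m \<in> Poly_Mapping.keys (Poly_Mapping.lookup f b) \<Longrightarrow> total_degree m + \<delta> b = j"
  by (auto simp: homogeneous_def)

lemma subspace_homogeneous: "module.subspace kscale (homogeneous \<delta> j)"
proof -
  have "homogeneous \<delta> j = {f. \<forall>b m. total_degree m + \<delta> b \<noteq> j
      \<longrightarrow> Poly_Mapping.lookup (Poly_Mapping.lookup f b) m = 0}"
    unfolding homogeneous_def by (auto simp: Ball_def in_keys_iff)
  then show ?thesis
    by (auto simp: kvs.subspace_def lookup_add kscale_def simp flip: mult_map_scale_conv_mult
        simp: Poly_Mapping.map.rep_eq)
qed

lemma bvec_homogeneous: "bvec b \<in> homogeneous \<delta> (\<delta> b)"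
  by (auto simp: homogeneous_def lookup_single when_def)

lemma rscale_homogeneous:
  assumes "\<And>m. m \<in> Poly_Mapping.keys r \<Longrightarrow> total_degree m + i = j" and "f \<in> homogeneous \<delta> i"
  shows "rscale r f \<in> homogeneous \<delta> j"
  unfolding homogeneous_def
proof (intro CollectI allI ballI)
  fix b m assume "m \<in> Poly_Mapping.keys (Poly_Mapping.lookup (rscale r f) b)"
  then obtain u v where "m = u + v" "u \<in> Poly_Mapping.keys r"
      "v \<in> Poly_Mapping.keys (Poly_Mapping.lookup f b)"
    using keys_mult by fastforce
  with assms(1)[of u] homogeneousD[OF assms(2), of v b]
  show "total_degree m + \<delta> b = j" by simp
qed

definition graded_hom ::
    "nat set \<Rightarrow> (nat \<Rightarrow> nat) \<Rightarrow> nat set \<Rightarrow> (nat \<Rightarrow> nat)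
      \<Rightarrow> (('p::finite, 'k::field) free \<Rightarrow> ('p, 'k) free) \<Rightarrow> bool" where
  "graded_hom S \<delta> T \<delta>' h \<longleftrightarrow>
     module_hom rscale rscale h \<and> h ` free_on S \<subseteq> free_on T \<and>
     (\<forall>j. h ` (free_on S \<inter> homogeneous \<delta> j) \<subseteq> homogeneous \<delta>' j)"

lemma graded_homD:
  assumes "graded_hom S \<delta> T \<delta>' h"
  shows "module_hom rscale rscale h" "f \<in> free_on S \<Longrightarrow> h f \<in> free_on T"
    "f \<in> free_on S \<Longrightarrow> f \<in> homogeneous \<delta> j \<Longrightarrow> h f \<in> homogeneous \<delta>' j"
  using assms by (auto simp: graded_hom_def)

lemma graded_hom_comp:
  "graded_hom S \<delta> T \<delta>' g \<Longrightarrow> graded_hom T \<delta>' U \<delta>'' h \<Longrightarrow> graded_hom S \<delta> U \<delta>'' (h \<circ> g)"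
  unfolding graded_hom_def using module_hom_compose by (auto simp: image_subset_iff)

lemma graded_hom_diff:
  fixes g h :: "('p::finite, 'k::field) free \<Rightarrow> ('p, 'k) free"
  assumes "graded_hom S \<delta> T \<delta>' g" "graded_hom S \<delta> T \<delta>' h"
  shows "graded_hom S \<delta> T \<delta>' (\<lambda>f. g f - h f)"
  unfolding graded_hom_def
proof (intro conjI allI subsetI; (elim imageE)?; (hypsubst)?)
  show "module_hom rscale rscale (\<lambda>f. g f - h f)"
    by (rule module_pair.module_hom_sub[OF module_pair.intro[OF module_rscale module_rscale]
      graded_homD(1)[OF assms(1)] graded_homD(1)[OF assms(2)]])
next
  fix f :: "('p, 'k) free" assume "f \<in> free_on S"
  then show "g f - h f \<in> free_on T"
    by (intro rmod.subspace_diff[OF subspace_free_on] graded_homD(2)[OF assms(1)]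
        graded_homD(2)[OF assms(2)])
next
  fix f :: "('p, 'k) free" and j assume "f \<in> free_on S \<inter> homogeneous \<delta> j"
  then show "g f - h f \<in> homogeneous \<delta>' j"
    by (intro kvs.subspace_diff[OF subspace_homogeneous] graded_homD(3)[OF assms(1)]
        graded_homD(3)[OF assms(2)]) auto
qed

lemma graded_hom_ident: "graded_hom S \<delta> S \<delta> (\<lambda>f. f)"
  unfolding graded_hom_def using rmod.module_hom_ident by auto

text \<open>Maps out of a free module may be prescribed on the basis; homogeneity needs to be arranged
  only there.\<close>

lemma graded_hom_basis_extend:
  fixes y :: "nat \<Rightarrow> ('p::finite, 'k::field) free"
  assumes y: "\<And>b. b \<in> S \<Longrightarrow> y b \<in> free_on T \<inter> homogeneous \<delta>' (\<delta> b)"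
  shows "graded_hom S \<delta> T \<delta>' (basis_extend y)"
  unfolding graded_hom_def
proof (intro conjI module_hom_basis_extend allI subsetI; elim imageE; hypsubst)
  fix f :: "('p, 'k) free" assume f: "f \<in> free_on S"
  show "basis_extend y f \<in> free_on T" unfolding basis_extend_def
    using y f by (intro rmod.subspace_sum[OF subspace_free_on] rmod.subspace_scale[OF subspace_free_on])
      (auto simp: free_on_def)
next
  fix f :: "('p, 'k) free" and j assume f: "f \<in> free_on S \<inter> homogeneous \<delta> j"
  show "basis_extend y f \<in> homogeneous \<delta>' j" unfolding basis_extend_def
    using y f by (intro kvs.subspace_sum[OF subspace_homogeneous] rscale_homogeneous[of _ "\<delta> _"])
      (auto simp: free_on_def dest: homogeneousD)
qed

definition component :: "(nat \<Rightarrow> nat) \<Rightarrow> nat \<Rightarrow> ('p::finite, 'k::field) free \<Rightarrow> ('p, 'k) free" where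
  "component \<delta> n f =
     Poly_Mapping.mapp (\<lambda>b. Poly_Mapping.mapp (\<lambda>m c. c when total_degree m + \<delta> b = n)) f"

lemma lookup_component:
  "Poly_Mapping.lookup (Poly_Mapping.lookup (component \<delta> n f) b) m =
     (Poly_Mapping.lookup (Poly_Mapping.lookup f b) m when total_degree m + \<delta> b = n)"
  by (simp add: component_def lookup_mapp when_def in_keys_iff)

lemma component_free_on: "f \<in> free_on S \<Longrightarrow> component \<delta> n f \<in> free_on S"
  by (simp add: free_on_def component_def subset_trans[OF keys_mapp_subset])

lemma component_homogeneous: "component \<delta> n f \<in> homogeneous \<delta> n"
  by (auto simp: homogeneous_def in_keys_iff lookup_component)

lemma component_self: "f \<in> homogeneous \<delta> n \<Longrightarrow> component \<delta> n f = f"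
  by (intro poly_mapping_eqI) (auto simp: lookup_component when_def in_keys_iff dest: homogeneousD)

lemma component_eq_0: "f \<in> homogeneous \<delta> j \<Longrightarrow> j \<noteq> n \<Longrightarrow> component \<delta> n f = 0"
  by (intro poly_mapping_eqI) (auto simp: lookup_component when_def in_keys_iff dest: homogeneousD)

lemma component_sum: "component \<delta> n (sum f A) = (\<Sum>x\<in>A. component \<delta> n (f x))"
  by (intro poly_mapping_eqI) (auto simp: lookup_component lookup_sum when_def)

lemma component_decomposition:
  obtains N where "finite N" "f = (\<Sum>j\<in>N. component \<delta> j f)"
proof
  let ?N = "\<Union>b\<in>Poly_Mapping.keys f. (\<lambda>m. total_degree m + \<delta> b) ` Poly_Mapping.keys (Poly_Mapping.lookup f b)"
  show fin: "finite ?N" by auto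
  show "f = (\<Sum>j\<in>?N. component \<delta> j f)"
  proof (intro poly_mapping_eqI)
    fix b m
    have "total_degree m + \<delta> b \<in> ?N" if "Poly_Mapping.lookup (Poly_Mapping.lookup f b) m \<noteq> 0"
    proof -
      have "b \<in> Poly_Mapping.keys f" using that by (auto simp: in_keys_iff)
      moreover have "m \<in> Poly_Mapping.keys (Poly_Mapping.lookup f b)"
        using that by (simp add: in_keys_iff)
      ultimately show ?thesis by blast
    qed
    moreover have "(\<Sum>j\<in>?N. Poly_Mapping.lookup (Poly_Mapping.lookup f b) m when total_degree m + \<delta> b = j)
        = (if total_degree m + \<delta> b \<in> ?N then Poly_Mapping.lookup (Poly_Mapping.lookup f b) m else 0)"
      unfolding when_def using fin by (subst sum.delta'[symmetric]) auto
    ultimately show "Poly_Mapping.lookup (Poly_Mapping.lookup f b) m =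
        Poly_Mapping.lookup (Poly_Mapping.lookup (\<Sum>j\<in>?N. component \<delta> j f) b) m"
      by (auto simp: lookup_sum lookup_component)
  qed
qed

text \<open>A graded map sends the degree \<open>j\<close> component into degree \<open>j\<close>; decompose the argument into its finitely
  many components and compare degree \<open>n\<close> on both sides.\<close>

lemma component_graded_hom:
  assumes h: "graded_hom S \<delta> T \<delta>' h" and f: "f \<in> free_on S"
  shows "h (component \<delta> n f) = component \<delta>' n (h f)"
proof -
  obtain N where N: "finite N" "f = (\<Sum>j\<in>N. component \<delta> j f)" by (rule component_decomposition)
  have hc: "h (component \<delta> j f) \<in> homogeneous \<delta>' j" for j
    using graded_homD(3)[OF h component_free_on[OF f] component_homogeneous] .
  have "component \<delta>' n (h f) = component \<delta>' n (\<Sum>j\<in>N. h (component \<delta> j f))"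
    using N(2) module_hom.sum[OF graded_homD(1)[OF h]] by metis
  also have "\<dots> = (\<Sum>j\<in>N. if j = n then h (component \<delta> n f) else 0)"
    unfolding component_sum by (rule sum.cong) (use hc in \<open>auto simp: component_self intro: component_eq_0\<close>)
  also have "\<dots> = h (component \<delta> n f)"
  proof (cases "n \<in> N")
    case False
    have "component \<delta> n f = (\<Sum>j\<in>N. component \<delta> n (component \<delta> j f))"
      using N(2) component_sum by metis
    also have "\<dots> = 0"
      using False by (intro sum.neutral ballI component_eq_0[OF component_homogeneous]) auto
    finally show ?thesis
      using False N(1) module_hom.zero[OF graded_homD(1)[OF h]] by simp
  qed (use N(1) in simp)
  finally show ?thesis by simp
qed

section \<open>Comparison of graded free resolutions\<close>

text \<open>In position \<open>0\<close> the kernel of the augmentation is meant, so that exactness has the same shape in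
  every position.\<close>

definition cycles :: "('p::finite, 'k::field) aug_complex \<Rightarrow> nat \<Rightarrow> ('p, 'k) free set" where
  "cycles F i = {f \<in> free_on (gens F i). if i = 0 then aug F f = 0 else diff F i f = 0}"

context
  fixes F :: "('p::finite, 'k::field) aug_complex"
  assumes F: "graded_free_resolution F"
begin

lemma resolution_diff_hom: "module_hom rscale rscale (diff F i)"
  using F by (simp add: graded_free_resolution_def)

lemma resolution_diff_graded:
  "graded_hom (gens F (Suc i)) (gdeg F (Suc i)) (gens F i) (gdeg F i) (diff F (Suc i))"
  using F by (simp add: graded_free_resolution_def graded_hom_def)

lemma resolution_aug_hom: "module_hom rscale residue_scale (aug F)"
  using F by (simp add: graded_free_resolution_def)

lemma resolution_aug_degree:
  assumes "f \<in> free_on (gens F 0)" "f \<in> homogeneous (gdeg F 0) j" "j \<noteq> 0"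
  shows "aug F f = 0"
proof -
  have "\<forall>j. j \<noteq> 0 \<longrightarrow> aug F ` (free_on (gens F 0) \<inter> homogeneous (gdeg F 0) j) \<subseteq> {0}"
    using F by (simp add: graded_free_resolution_def)
  then show ?thesis using assms by auto
qed

lemma resolution_exact: "cycles F i = diff F (Suc i) ` free_on (gens F (Suc i))"
  using F by (cases i) (auto simp: graded_free_resolution_def cycles_def)

lemma resolution_boundary_cycle: "f \<in> free_on (gens F (Suc i)) \<Longrightarrow> diff F (Suc i) f \<in> cycles F i"
  using resolution_exact by blast

text \<open>An arbitrary preimage exists by exactness; its component of degree \<open>j\<close> is again a preimage.\<close>

lemma graded_preimage:
  assumes "f \<in> cycles F i" "f \<in> homogeneous (gdeg F i) j"
  obtains g where "g \<in> free_on (gens F (Suc i))" "g \<in> homogeneous (gdeg F (Suc i)) j"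
    "diff F (Suc i) g = f"
proof -
  obtain g where g: "g \<in> free_on (gens F (Suc i))" "f = diff F (Suc i) g"
    using assms(1) resolution_exact by blast
  show ?thesis
    using that[OF component_free_on[OF g(1)] component_homogeneous]
      component_graded_hom[OF resolution_diff_graded g(1)] g(2) component_self[OF assms(2)] by simp
qed

text \<open>The augmentation vanishes on all components of nonzero degree, so only the component of degree
  \<open>0\<close> of an arbitrary preimage counts.\<close>

lemma aug_preimage:
  obtains g where "g \<in> free_on (gens F 0)" "g \<in> homogeneous (gdeg F 0) 0" "aug F g = c"
proof -
  have "c \<in> aug F ` free_on (gens F 0)" using F by (simp add: graded_free_resolution_def)
  then obtain g where g: "g \<in> free_on (gens F 0)" "aug F g = c" by blast
  obtain N where N: "finite N" "g = (\<Sum>j\<in>N. component (gdeg F 0) j g)"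
    by (rule component_decomposition)
  have zero: "aug F (component (gdeg F 0) j g) = 0" if "j \<noteq> 0" for j
    using resolution_aug_degree[OF component_free_on[OF g(1)] component_homogeneous that] .
  have "aug F g = (\<Sum>j\<in>N. aug F (component (gdeg F 0) j g))"
    using N(2) module_hom.sum[OF resolution_aug_hom] by metis
  also have "\<dots> = (\<Sum>j\<in>N. if j = 0 then aug F (component (gdeg F 0) 0 g) else 0)"
    by (rule sum.cong) (auto simp: zero)
  finally have "c = (if 0 \<in> N then aug F (component (gdeg F 0) 0 g) else 0)"
    using N(1) g(2) by simp
  moreover have "aug F 0 = 0" using module_hom.zero[OF resolution_aug_hom] .
  ultimately show ?thesis
    using that[OF component_free_on[OF g(1)] component_homogeneous]
      that[of 0] rmod.subspace_0[OF subspace_free_on] kvs.subspace_0[OF subspace_homogeneous]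
    by (metis (full_types))
qed

text \<open>The lifting property of free modules: choose homogeneous preimages of the images of the basis
  vectors.\<close>

lemma graded_lift:
  assumes \<alpha>: "graded_hom S \<delta> (gens F i) (gdeg F i) \<alpha>"
    and cyc: "\<And>f. f \<in> free_on S \<Longrightarrow> \<alpha> f \<in> cycles F i"
  obtains \<beta> where "graded_hom S \<delta> (gens F (Suc i)) (gdeg F (Suc i)) \<beta>"
    "\<And>f. f \<in> free_on S \<Longrightarrow> diff F (Suc i) (\<beta> f) = \<alpha> f"
proof -
  have "\<exists>g. g \<in> free_on (gens F (Suc i)) \<inter> homogeneous (gdeg F (Suc i)) (\<delta> b) \<and>
      diff F (Suc i) g = \<alpha> (bvec b)" if "b \<in> S" for b
  proof -
    have b: "bvec b \<in> free_on S" using that by (simp add: free_on_def)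
    from graded_preimage[OF cyc[OF b] graded_homD(3)[OF \<alpha> b bvec_homogeneous]] show ?thesis
      by blast
  qed
  then obtain y where y: "\<And>b. b \<in> S \<Longrightarrow>
      y b \<in> free_on (gens F (Suc i)) \<inter> homogeneous (gdeg F (Suc i)) (\<delta> b) \<and>
      diff F (Suc i) (y b) = \<alpha> (bvec b)" by metis
  show ?thesis
  proof (rule that)
    show "graded_hom S \<delta> (gens F (Suc i)) (gdeg F (Suc i)) (basis_extend y)"
      using y by (intro graded_hom_basis_extend) blast
    have "(diff F (Suc i) \<circ> basis_extend y) f = \<alpha> f" if "f \<in> free_on S" for f
      by (rule module_hom_eq_on_free[OF module_hom_compose[OF module_hom_basis_extend
            resolution_diff_hom] graded_homD(1)[OF \<alpha>] _ that]) (use y in simp)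
    then show "diff F (Suc i) (basis_extend y f) = \<alpha> f" if "f \<in> free_on S" for f
      using that by simp
  qed
qed

end

lemma graded_lift_aug:
  assumes F: "graded_free_resolution F" and G: "graded_free_resolution G"
  obtains \<beta> where "graded_hom (gens F 0) (gdeg F 0) (gens G 0) (gdeg G 0) \<beta>"
    "\<And>f. f \<in> free_on (gens F 0) \<Longrightarrow> aug G (\<beta> f) = aug F f"
proof -
  have "\<exists>g. g \<in> free_on (gens G 0) \<inter> homogeneous (gdeg G 0) (gdeg F 0 b) \<and>
      aug G g = aug F (bvec b)" if "b \<in> gens F 0" for b
  proof (cases "gdeg F 0 b = 0")
    case True
    then show ?thesis using aug_preimage[OF G, of "aug F (bvec b)"] by auto
  next
    case False
    have "bvec b \<in> free_on (gens F 0)" using that by (simp add: free_on_def)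
    then have "aug F (bvec b) = 0"
      using resolution_aug_degree[OF F _ bvec_homogeneous False] by blast
    then show ?thesis
      using module_hom.zero[OF resolution_aug_hom[OF G]] rmod.subspace_0[OF subspace_free_on]
        kvs.subspace_0[OF subspace_homogeneous] by (metis IntI)
  qed
  then obtain y where y: "\<And>b. b \<in> gens F 0 \<Longrightarrow>
      y b \<in> free_on (gens G 0) \<inter> homogeneous (gdeg G 0) (gdeg F 0 b) \<and>
      aug G (y b) = aug F (bvec b)" by metis
  show ?thesis
  proof (rule that)
    show "graded_hom (gens F 0) (gdeg F 0) (gens G 0) (gdeg G 0) (basis_extend y)"
      using y by (intro graded_hom_basis_extend) blast
    have "(aug G \<circ> basis_extend y) f = aug F f" if "f \<in> free_on (gens F 0)" for f
      by (rule module_hom_eq_on_free[OF module_hom_compose[OF module_hom_basis_extend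
            resolution_aug_hom[OF G]] resolution_aug_hom[OF F] _ that]) (use y in simp)
    then show "aug G (basis_extend y f) = aug F f" if "f \<in> free_on (gens F 0)" for f
      using that by simp
  qed
qed

text \<open>These are the graded chain maps that lift the identity of the residue field.\<close>

definition chain_map ::
    "('p::finite, 'k::field) aug_complex \<Rightarrow> ('p, 'k) aug_complex
      \<Rightarrow> (nat \<Rightarrow> ('p, 'k) free \<Rightarrow> ('p, 'k) free) \<Rightarrow> bool" where
  "chain_map F G \<phi> \<longleftrightarrow>
     (\<forall>i. graded_hom (gens F i) (gdeg F i) (gens G i) (gdeg G i) (\<phi> i)) \<and>
     (\<forall>f\<in>free_on (gens F 0). aug G (\<phi> 0 f) = aug F f) \<and>
     (\<forall>i. \<forall>f\<in>free_on (gens F (Suc i)). diff G (Suc i) (\<phi> (Suc i) f) = \<phi> i (diff F (Suc i) f))"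

lemma chain_mapD:
  assumes "chain_map F G \<phi>"
  shows "graded_hom (gens F i) (gdeg F i) (gens G i) (gdeg G i) (\<phi> i)"
    "f \<in> free_on (gens F 0) \<Longrightarrow> aug G (\<phi> 0 f) = aug F f"
    "f \<in> free_on (gens F (Suc i)) \<Longrightarrow> diff G (Suc i) (\<phi> (Suc i) f) = \<phi> i (diff F (Suc i) f)"
  using assms by (auto simp: chain_map_def)

text \<open>The maps are built position by position; the invariant that cycles go to cycles is what allows the
  next lift.\<close>

lemma chain_map_exists:
  assumes F: "graded_free_resolution F" and G: "graded_free_resolution G"
  obtains \<phi> where "chain_map F G \<phi>"
proof -
  let ?P = "\<lambda>n h. graded_hom (gens F n) (gdeg F n) (gens G n) (gdeg G n) h \<and>
      (\<forall>f\<in>cycles F n. h f \<in> cycles G n) \<and>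
      (n = 0 \<longrightarrow> (\<forall>f\<in>free_on (gens F 0). aug G (h f) = aug F f))"
  let ?Q = "\<lambda>n h h'. \<forall>f\<in>free_on (gens F (Suc n)). diff G (Suc n) (h' f) = h (diff F (Suc n) f)"
  have "\<exists>\<phi>. \<forall>n. ?P n (\<phi> n) \<and> ?Q n (\<phi> n) (\<phi> (Suc n))"
  proof (rule dependent_nat_choice)
    obtain \<beta> where "graded_hom (gens F 0) (gdeg F 0) (gens G 0) (gdeg G 0) \<beta>"
      "\<And>f. f \<in> free_on (gens F 0) \<Longrightarrow> aug G (\<beta> f) = aug F f"
      using graded_lift_aug[OF F G] by blast
    then show "\<exists>h. ?P 0 h"
      by (auto simp: cycles_def dest: graded_homD(2) intro!: exI[of _ \<beta>])
  next
    fix h n assume h: "?P n h"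
    have h1: "graded_hom (gens F n) (gdeg F n) (gens G n) (gdeg G n) h" using h by blast
    have "(h \<circ> diff F (Suc n)) f \<in> cycles G n" if "f \<in> free_on (gens F (Suc n))" for f
      using h resolution_boundary_cycle[OF F that] by auto
    from graded_lift[OF G graded_hom_comp[OF resolution_diff_graded[OF F] h1] this]
    obtain \<beta> where \<beta>: "graded_hom (gens F (Suc n)) (gdeg F (Suc n)) (gens G (Suc n)) (gdeg G (Suc n)) \<beta>"
        "\<And>f. f \<in> free_on (gens F (Suc n)) \<Longrightarrow> diff G (Suc n) (\<beta> f) = h (diff F (Suc n) f)"
      by (metis comp_apply)
    have "\<beta> f \<in> cycles G (Suc n)" if "f \<in> cycles F (Suc n)" for f
      using that \<beta> graded_homD(2)[OF \<beta>(1)] module_hom.zero[OF graded_homD(1)[OF h1]]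
      by (auto simp: cycles_def)
    with \<beta> show "\<exists>h'. ?P (Suc n) h' \<and> ?Q n h h'" by blast
  qed
  then obtain \<phi> where \<phi>: "\<forall>n. ?P n (\<phi> n) \<and> ?Q n (\<phi> n) (\<phi> (Suc n))" by (rule exE)
  have "chain_map F G \<phi>" unfolding chain_map_def using \<phi> by simp
  then show ?thesis by (rule that)
qed

lemma chain_map_comp:
  assumes F: "graded_free_resolution F"
    and \<phi>: "chain_map F G \<phi>" and \<psi>: "chain_map G H \<psi>"
  shows "chain_map F H (\<lambda>i. \<psi> i \<circ> \<phi> i)"
  unfolding chain_map_def
proof (intro conjI allI ballI)
  note [simp] = chain_mapD(2,3)[OF \<phi>] chain_mapD(2,3)[OF \<psi>] graded_homD(2)[OF chain_mapD(1)[OF \<phi>]]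
  show "graded_hom (gens F i) (gdeg F i) (gens H i) (gdeg H i) (\<psi> i \<circ> \<phi> i)" for i
    using graded_hom_comp[OF chain_mapD(1)[OF \<phi>] chain_mapD(1)[OF \<psi>]] .
  show "aug H ((\<psi> 0 \<circ> \<phi> 0) f) = aug F f" if "f \<in> free_on (gens F 0)" for f
    using that by simp
  show "diff H (Suc i) ((\<psi> (Suc i) \<circ> \<phi> (Suc i)) f) = (\<psi> i \<circ> \<phi> i) (diff F (Suc i) f)"
    if "f \<in> free_on (gens F (Suc i))" for i f
    using that by simp
qed

text \<open>The difference \<open>\<eta>\<close> between the chain map and the identity lifts zero. The homotopy \<open>s\<close> is built by lifting
  \<open>\<eta> - s d\<close>, which takes values in the cycles because \<open>d s = \<eta>\<close> already holds on cycles one position lower.\<close>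

lemma chain_map_homotopy:
  assumes F: "graded_free_resolution F" and \<theta>: "chain_map F F \<theta>"
  obtains s where
    "\<And>i. graded_hom (gens F i) (gdeg F i) (gens F (Suc i)) (gdeg F (Suc i)) (s i)"
    "\<And>i f. f \<in> free_on (gens F (Suc i)) \<Longrightarrow>
       \<theta> (Suc i) f - f = diff F (Suc (Suc i)) (s (Suc i) f) + s i (diff F (Suc i) f)"
proof -
  define \<eta> where "\<eta> i f = \<theta> i f - f" for i f
  have \<theta>g: "graded_hom (gens F i) (gdeg F i) (gens F i) (gdeg F i) (\<theta> i)" for i
    using \<theta> by (simp add: chain_map_def)
  have \<eta>g: "graded_hom (gens F i) (gdeg F i) (gens F i) (gdeg F i) (\<eta> i)" for i
    unfolding \<eta>_def using graded_hom_diff[OF \<theta>g graded_hom_ident] .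
  have \<eta>d: "diff F (Suc i) (\<eta> (Suc i) f) = \<eta> i (diff F (Suc i) f)" if "f \<in> free_on (gens F (Suc i))" for i f
    using \<theta> that by (simp add: \<eta>_def chain_map_def module_hom.diff[OF resolution_diff_hom[OF F]])
  have \<eta>0: "\<eta> 0 f \<in> cycles F 0" if "f \<in> free_on (gens F 0)" for f
    using \<theta> that graded_homD(2)[OF \<eta>g that]
    by (simp add: cycles_def chain_map_def \<eta>_def module_hom.diff[OF resolution_aug_hom[OF F]])
  let ?P = "\<lambda>n h. graded_hom (gens F n) (gdeg F n) (gens F (Suc n)) (gdeg F (Suc n)) h \<and>
      (\<forall>f\<in>cycles F n. diff F (Suc n) (h f) = \<eta> n f)"
  let ?Q = "\<lambda>n h h'. \<forall>f\<in>free_on (gens F (Suc n)).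
      \<eta> (Suc n) f = diff F (Suc (Suc n)) (h' f) + h (diff F (Suc n) f)"
  have "\<exists>s. \<forall>n. ?P n (s n) \<and> ?Q n (s n) (s (Suc n))"
  proof (rule dependent_nat_choice)
    obtain \<beta> where "graded_hom (gens F 0) (gdeg F 0) (gens F (Suc 0)) (gdeg F (Suc 0)) \<beta>"
      "\<And>f. f \<in> free_on (gens F 0) \<Longrightarrow> diff F (Suc 0) (\<beta> f) = \<eta> 0 f"
      using graded_lift[OF F \<eta>g \<eta>0] by blast
    then show "\<exists>h. ?P 0 h" by (auto simp: cycles_def)
  next
    fix h n assume h: "?P n h"
    have h1: "graded_hom (gens F n) (gdeg F n) (gens F (Suc n)) (gdeg F (Suc n)) h" using h by blast
    let ?\<alpha> = "\<lambda>f. \<eta> (Suc n) f - (h \<circ> diff F (Suc n)) f"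
    have \<alpha>: "graded_hom (gens F (Suc n)) (gdeg F (Suc n)) (gens F (Suc n)) (gdeg F (Suc n)) ?\<alpha>"
      using graded_hom_diff[OF \<eta>g graded_hom_comp[OF resolution_diff_graded[OF F] h1]] .
    have "?\<alpha> f \<in> cycles F (Suc n)" if f: "f \<in> free_on (gens F (Suc n))" for f
      using graded_homD(2)[OF \<alpha> f] h resolution_boundary_cycle[OF F f] \<eta>d[OF f]
      by (simp add: cycles_def[of F "Suc n"] module_hom.diff[OF resolution_diff_hom[OF F]])
    from graded_lift[OF F \<alpha> this] obtain \<beta> where
      \<beta>: "graded_hom (gens F (Suc n)) (gdeg F (Suc n)) (gens F (Suc (Suc n))) (gdeg F (Suc (Suc n))) \<beta>"
        "\<And>f. f \<in> free_on (gens F (Suc n)) \<Longrightarrow> diff F (Suc (Suc n)) (\<beta> f) = ?\<alpha> f"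
      by blast
    have "diff F (Suc (Suc n)) (\<beta> f) = \<eta> (Suc n) f" if "f \<in> cycles F (Suc n)" for f
      using that \<beta>(2) module_hom.zero[OF graded_homD(1)[OF h1]] by (auto simp: cycles_def)
    moreover have "?Q n h \<beta>" using \<beta>(2) by simp
    ultimately show "\<exists>h'. ?P (Suc n) h' \<and> ?Q n h h'" using \<beta>(1) by blast
  qed
  then obtain s where s: "\<forall>n. ?P n (s n) \<and> ?Q n (s n) (s (Suc n))" by (rule exE)
  show ?thesis
  proof (rule that[of s])
    show "graded_hom (gens F i) (gdeg F i) (gens F (Suc i)) (gdeg F (Suc i)) (s i)" for i
      using s by simp
    show "\<theta> (Suc i) f - f = diff F (Suc (Suc i)) (s (Suc i) f) + s i (diff F (Suc i) f)"
      if "f \<in> free_on (gens F (Suc i))" for i f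
      using s that by (simp add: \<eta>_def)
  qed
qed

section \<open>Independence of Tor from the resolution\<close>

lemma hom_preserves_ideal_coordinates:
  assumes I: "module.subspace (*) I" and h: "module_hom rscale rscale h"
    and "\<And>b. Poly_Mapping.lookup f b \<in> I"
  shows "Poly_Mapping.lookup (h f) c \<in> I"
proof -
  have "Poly_Mapping.lookup (h (bvec b)) c * Poly_Mapping.lookup f b \<in> I" for b
    using ideals.subspace_scale[OF I assms(3)] .
  then have "Poly_Mapping.lookup f b * Poly_Mapping.lookup (h (bvec b)) c \<in> I" for b
    by (simp add: mult.commute)
  then show ?thesis
    unfolding module_hom_expand[OF h, of f]
    by (auto simp: lookup_sum intro!: ideals.subspace_sum[OF I])
qed

context
  fixes I :: "('p::finite, 'k::field) polyring set"
  assumes I: "module.subspace (*) I"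
begin

lemma subspace_ideal_times_free: "module.subspace rscale (ideal_times_free I S)"
  using subspace_free_on[of S] I
  unfolding ideal_times_free_def rmod.subspace_def ideals.subspace_def by (auto simp: lookup_add)

lemma subspace_tor_cycles:
  assumes "graded_free_resolution F"
  shows "module.subspace rscale (tor_cycles F I i)"
proof -
  note h = resolution_diff_hom[OF assms, of i]
  show ?thesis
    using subspace_free_on[of "gens F i"] I module_hom.add[OF h] module_hom.scale[OF h]
      module_hom.zero[OF h]
    unfolding tor_cycles_def rmod.subspace_def ideals.subspace_def by (auto simp: lookup_add)
qed

lemma subspace_tor_boundaries:
  assumes "graded_free_resolution F"
  shows "module.subspace rscale (tor_boundaries F I i)"
proof -
  have "tor_boundaries F I i =
      {x + y | x y. x \<in> diff F (Suc i) ` free_on (gens F (Suc i)) \<and> y \<in> ideal_times_free I (gens F i)}"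
    unfolding tor_boundaries_def by blast
  moreover have "module.subspace rscale (diff F (Suc i) ` free_on (gens F (Suc i)))"
    using module_hom.subspace_image[OF resolution_diff_hom[OF assms] subspace_free_on] .
  moreover have "module.subspace rscale {x + y | x y. x \<in> A \<and> y \<in> B}"
    if A: "module.subspace rscale A" and B: "module.subspace rscale B" for A B :: "('p, 'k) free set"
  proof (rule rmod.subspaceI)
    show "0 \<in> {x + y | x y. x \<in> A \<and> y \<in> B}"
      using rmod.subspace_0[OF A] rmod.subspace_0[OF B] by force
  next
    fix u v assume "u \<in> {x + y | x y. x \<in> A \<and> y \<in> B}" "v \<in> {x + y | x y. x \<in> A \<and> y \<in> B}"
    then obtain x y x' y' where u: "u = x + y" "x \<in> A" "y \<in> B" and v: "v = x' + y'" "x' \<in> A" "y' \<in> B"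
      by blast
    then have "u + v = (x + x') + (y + y')" by (simp add: algebra_simps)
    then show "u + v \<in> {x + y | x y. x \<in> A \<and> y \<in> B}"
      using rmod.subspace_add[OF A u(2) v(2)] rmod.subspace_add[OF B u(3) v(3)] by blast
  next
    fix r u assume "u \<in> {x + y | x y. x \<in> A \<and> y \<in> B}"
    then obtain x y where u: "u = x + y" "x \<in> A" "y \<in> B" by blast
    then have "rscale r u = rscale r x + rscale r y" by (simp add: rmod.scale_right_distrib)
    then show "rscale r u \<in> {x + y | x y. x \<in> A \<and> y \<in> B}"
      using rmod.subspace_scale[OF A u(2)] rmod.subspace_scale[OF B u(3)] by blast
  qed
  ultimately show ?thesis using subspace_ideal_times_free by simp
qed

lemma chain_map_tor_cycles:
  assumes \<phi>: "chain_map F G \<phi>" and f: "f \<in> tor_cycles F I (Suc i)"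
  shows "\<phi> (Suc i) f \<in> tor_cycles G I (Suc i)"
  using f graded_homD(2)[OF chain_mapD(1)[OF \<phi>]] chain_mapD(3)[OF \<phi>]
    hom_preserves_ideal_coordinates[OF I graded_homD(1)[OF chain_mapD(1)[OF \<phi>]]]
  by (auto simp: tor_cycles_def)

lemma hom_ideal_times_free:
  assumes "graded_hom S \<delta> T \<delta>' h" "f \<in> ideal_times_free I S"
  shows "h f \<in> ideal_times_free I T"
  using assms(2) graded_homD(2)[OF assms(1)] hom_preserves_ideal_coordinates[OF I graded_homD(1)[OF assms(1)]]
  by (auto simp: ideal_times_free_def)

lemma chain_map_tor_boundaries:
  assumes \<phi>: "chain_map F G \<phi>" and f: "f \<in> tor_boundaries F I i"
  shows "\<phi> i f \<in> tor_boundaries G I i"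
proof -
  note gr = chain_mapD(1)[OF \<phi>]
  obtain g h where g: "g \<in> free_on (gens F (Suc i))" and h: "h \<in> ideal_times_free I (gens F i)"
    and "f = diff F (Suc i) g + h"
    using f unfolding tor_boundaries_def by blast
  then have "\<phi> i f = diff G (Suc i) (\<phi> (Suc i) g) + \<phi> i h"
    by (simp add: module_hom.add[OF graded_homD(1)[OF gr]] chain_mapD(3)[OF \<phi>])
  then show ?thesis
    unfolding tor_boundaries_def using graded_homD(2)[OF gr g] hom_ideal_times_free[OF gr h] by blast
qed

text \<open>For a cycle \<open>f\<close> modulo \<open>I\<close> the homotopy writes \<open>\<theta> f - f\<close> as a boundary plus \<open>s (d f)\<close>, and the coordinates of
  \<open>d f\<close> lie in \<open>I\<close>.\<close>

lemma chain_map_tor_identity: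
  assumes F: "graded_free_resolution F" and \<theta>: "chain_map F F \<theta>"
    and f: "f \<in> tor_cycles F I (Suc i)"
  shows "\<theta> (Suc i) f - f \<in> tor_boundaries F I (Suc i)"
proof -
  from chain_map_homotopy[OF F \<theta>] obtain s where
    s: "\<And>i. graded_hom (gens F i) (gdeg F i) (gens F (Suc i)) (gdeg F (Suc i)) (s i)"
    and eq: "\<And>i f. f \<in> free_on (gens F (Suc i)) \<Longrightarrow>
       \<theta> (Suc i) f - f = diff F (Suc (Suc i)) (s (Suc i) f) + s i (diff F (Suc i) f)"
    by blast
  have ff: "f \<in> free_on (gens F (Suc i))" using f by (simp add: tor_cycles_def)
  have "diff F (Suc i) f \<in> ideal_times_free I (gens F i)"
    using f graded_homD(2)[OF resolution_diff_graded[OF F] ff]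
    by (simp add: tor_cycles_def ideal_times_free_def)
  then have "s i (diff F (Suc i) f) \<in> ideal_times_free I (gens F (Suc i))"
    by (rule hom_ideal_times_free[OF s])
  then show ?thesis
    unfolding tor_boundaries_def eq[OF ff] using graded_homD(2)[OF s ff] by blast
qed

text \<open>Any two graded free resolutions of the residue field compute the same Tor, degree by degree: chain
  maps in both directions are inverse to each other up to homotopy, so a dual system for one
  resolution yields one for the other. In positive homological degree, Betti numbers taken
  with the chosen resolution can thus be read off from the Koszul complex.\<close>

lemma tor_dual_system_transfer:
  assumes F: "graded_free_resolution F" and G: "graded_free_resolution G"
  obtains f g where "\<And>(b :: 't \<Rightarrow> _) \<phi> J.
      dual_system (tor_cycles G I (Suc i)) (tor_boundaries G I (Suc i)) b \<phi> J \<Longrightarrow>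
      dual_system (tor_cycles F I (Suc i)) (tor_boundaries F I (Suc i)) (f \<circ> b) (\<lambda>t. \<phi> t \<circ> g) J"
    "\<And>(b :: 't \<Rightarrow> _) \<phi> J.
      dual_system (tor_cycles G I (Suc i) \<inter> homogeneous (gdeg G (Suc i)) j)
        (tor_boundaries G I (Suc i) \<inter> homogeneous (gdeg G (Suc i)) j) b \<phi> J \<Longrightarrow>
      dual_system (tor_cycles F I (Suc i) \<inter> homogeneous (gdeg F (Suc i)) j)
        (tor_boundaries F I (Suc i) \<inter> homogeneous (gdeg F (Suc i)) j) (f \<circ> b) (\<lambda>t. \<phi> t \<circ> g) J"
proof -
  obtain \<psi> where \<psi>: "chain_map G F \<psi>" using chain_map_exists[OF G F] .
  obtain \<chi> where \<chi>: "chain_map F G \<chi>" using chain_map_exists[OF F G] .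
  let ?f = "\<psi> (Suc i)" and ?g = "\<chi> (Suc i)"
  note \<psi>h = chain_mapD(1)[OF \<psi>, of "Suc i"] and \<chi>h = chain_mapD(1)[OF \<chi>, of "Suc i"]
  have khom: "module_hom kscale kscale ?f" "module_hom kscale kscale ?g"
    using graded_homD(1)[OF \<psi>h] graded_homD(1)[OF \<chi>h] by (auto intro: module_hom_kscale)
  have gf: "?g (?f z) - z \<in> tor_boundaries G I (Suc i)" if "z \<in> tor_cycles G I (Suc i)" for z
    using chain_map_tor_identity[OF G chain_map_comp[OF G \<psi> \<chi>] that] by simp
  have fg: "?f (?g z) - z \<in> tor_boundaries F I (Suc i)" if "z \<in> tor_cycles F I (Suc i)" for z
    using chain_map_tor_identity[OF F chain_map_comp[OF F \<chi> \<psi>] that] by simp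
  note sub = subspace_kscale[OF subspace_tor_cycles[OF F, of "Suc i"]]
    subspace_kscale[OF subspace_tor_boundaries[OF F, of "Suc i"]]
  have fb: "f \<in> free_on (gens H i)" if "f \<in> tor_cycles H I i"
    for H :: "('p, 'k) aug_complex" and f i
    using that by (simp add: tor_cycles_def)
  have bfree: "f \<in> free_on (gens H (Suc i))" if H: "graded_free_resolution H" and "f \<in> tor_boundaries H I (Suc i)"
    for H :: "('p, 'k) aug_complex" and f i
    using that(2) unfolding tor_boundaries_def ideal_times_free_def
    by (auto intro!: rmod.subspace_add[OF subspace_free_on] graded_homD(2)[OF resolution_diff_graded[OF H]])
  show ?thesis
  proof (rule that[of ?f ?g])
    fix b :: "'t \<Rightarrow> ('p, 'k) free" and \<phi> J
    assume "dual_system (tor_cycles G I (Suc i)) (tor_boundaries G I (Suc i)) b \<phi> J"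
    then show "dual_system (tor_cycles F I (Suc i)) (tor_boundaries F I (Suc i)) (?f \<circ> b) (\<lambda>t. \<phi> t \<circ> ?g) J"
      by (rule dual_system_transfer[OF _ sub khom])
        (use \<psi> \<chi> gf fg in \<open>auto intro: chain_map_tor_cycles chain_map_tor_boundaries\<close>)
  next
    fix b :: "'t \<Rightarrow> ('p, 'k) free" and \<phi> J
    let ?HG = "homogeneous (gdeg G (Suc i)) j" and ?HF = "homogeneous (gdeg F (Suc i)) j"
    have hf: "?f z \<in> ?HF" if "z \<in> free_on (gens G (Suc i))" "z \<in> ?HG" for z
      using graded_homD(3)[OF \<psi>h that] .
    have hg: "?g z \<in> ?HG" if "z \<in> free_on (gens F (Suc i))" "z \<in> ?HF" for z
      using graded_homD(3)[OF \<chi>h that] .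
    assume "dual_system (tor_cycles G I (Suc i) \<inter> ?HG) (tor_boundaries G I (Suc i) \<inter> ?HG) b \<phi> J"
    then show "dual_system (tor_cycles F I (Suc i) \<inter> ?HF) (tor_boundaries F I (Suc i) \<inter> ?HF)
        (?f \<circ> b) (\<lambda>t. \<phi> t \<circ> ?g) J"
    proof (rule dual_system_transfer[OF _ _ _ khom])
      show "kvs.subspace (tor_cycles F I (Suc i) \<inter> ?HF)" "kvs.subspace (tor_boundaries F I (Suc i) \<inter> ?HF)"
        using sub subspace_homogeneous by (auto intro: kvs.subspace_inter)
    next
      fix z assume "z \<in> tor_cycles G I (Suc i) \<inter> ?HG"
      then show "?f z \<in> tor_cycles F I (Suc i) \<inter> ?HF"
        using chain_map_tor_cycles[OF \<psi>] hf fb by blast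
    next
      fix z assume "z \<in> tor_boundaries G I (Suc i) \<inter> ?HG"
      then show "?f z \<in> tor_boundaries F I (Suc i) \<inter> ?HF"
        using chain_map_tor_boundaries[OF \<psi>] hf bfree[OF G] by blast
    next
      fix z assume "z \<in> tor_cycles F I (Suc i) \<inter> ?HF"
      then show "?g z \<in> tor_cycles G I (Suc i) \<inter> ?HG"
        using chain_map_tor_cycles[OF \<chi>] hg fb by blast
    next
      fix z assume "z \<in> tor_boundaries F I (Suc i) \<inter> ?HF"
      then show "?g z \<in> tor_boundaries G I (Suc i) \<inter> ?HG"
        using chain_map_tor_boundaries[OF \<chi>] hg bfree[OF F] by blast
    next
      fix z assume z: "z \<in> tor_cycles G I (Suc i) \<inter> ?HG"
      then have "?g (?f z) \<in> ?HG"
        using chain_map_tor_cycles[OF \<psi>] hf hg fb by blast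
      then show "?g (?f z) - z \<in> tor_boundaries G I (Suc i) \<inter> ?HG"
        using gf z kvs.subspace_diff[OF subspace_homogeneous] by blast
    next
      fix z assume z: "z \<in> tor_cycles F I (Suc i) \<inter> ?HF"
      then have "?f (?g z) \<in> ?HF"
        using chain_map_tor_cycles[OF \<chi>] hf hg fb by blast
      then show "?f (?g z) - z \<in> tor_boundaries F I (Suc i) \<inter> ?HF"
        using fg z kvs.subspace_diff[OF subspace_homogeneous] by blast
    qed
  qed
qed

end

section \<open>Chains of a simplex\<close>

text \<open>An arbitrary numbering of the variables; it fixes the order used for signs.\<close>

definition vertex_index :: "'p::finite \<Rightarrow> nat" where
  "vertex_index = (SOME f. inj f)"

text \<open>The basis vectors of the Koszul complex are labelled by subsets of the variables; this is a numbering
  of the subsets, because labels of basis vectors are natural numbers.\<close>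

definition face_index :: "'p::finite set \<Rightarrow> nat" where
  "face_index = (SOME f. inj f)"

lemma finite_inj_nat: "\<exists>f :: 'a::finite \<Rightarrow> nat. inj f"
  using finite_imp_inj_to_nat_seg[OF finite[of "UNIV :: 'a set"]] by auto

lemma inj_vertex_index: "inj vertex_index"
  unfolding vertex_index_def using someI_ex[OF finite_inj_nat] .

lemma inj_face_index: "inj face_index"
  unfolding face_index_def using someI_ex[OF finite_inj_nat] .

lemma face_index_eq_iff [simp]: "face_index \<sigma> = face_index \<tau> \<longleftrightarrow> \<sigma> = \<tau>"
  by (rule inj_eq[OF inj_face_index])

text \<open>For \<open>p \<notin> \<sigma>\<close> this is the sign in \<open>e\<^sub>p \<and> e\<^sub>\<sigma> = \<plusminus> e\<^bsub>insert p \<sigma>\<^esub>\<close>.\<close>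

definition insert_sign :: "'p::finite \<Rightarrow> 'p set \<Rightarrow> 'k::field" where
  "insert_sign p \<sigma> = (-1) ^ card {x \<in> \<sigma>. vertex_index x < vertex_index p}"

lemma insert_sign_square [simp]: "insert_sign p \<sigma> * insert_sign p \<sigma> = (1 :: 'k::field)"
  by (simp add: insert_sign_def flip: power_mult_distrib)

lemma insert_sign_nonzero [simp]: "insert_sign p \<sigma> \<noteq> (0 :: 'k::field)"
  by (simp add: insert_sign_def)

lemma insert_sign_insert:
  assumes "q \<notin> \<sigma>"
  shows "insert_sign p (insert q \<sigma>) =
    (if vertex_index q < vertex_index p then - insert_sign p \<sigma> else (insert_sign p \<sigma> :: 'k::field))"
proof -
  have "{x \<in> insert q \<sigma>. vertex_index x < vertex_index p} =
      (if vertex_index q < vertex_index p then insert q {x \<in> \<sigma>. vertex_index x < vertex_index p}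
       else {x \<in> \<sigma>. vertex_index x < vertex_index p})" by auto
  then show ?thesis using assms by (simp add: insert_sign_def)
qed

lemma vertex_index_linear: "p \<noteq> q \<Longrightarrow> vertex_index p < vertex_index q \<longleftrightarrow> \<not> vertex_index q < vertex_index p"
  using inj_vertex_index by (metis inj_eq linorder_neqE_nat not_less_iff_gr_or_eq)

text \<open>Inserting two vertices in the two possible orders gives opposite signs. The second form of the
  identity follows from the first since all signs are their own inverses.\<close>

lemma insert_sign_swap:
  assumes "p \<noteq> q" "p \<notin> \<rho>" "q \<notin> \<rho>"
  shows "insert_sign p \<rho> * insert_sign q (insert p \<rho>) =
     - (insert_sign q \<rho> * insert_sign p (insert q \<rho>) :: 'k::field)"
    and "insert_sign q (insert p \<rho>) * insert_sign p (insert q \<rho>) =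
     - (insert_sign p \<rho> * insert_sign q \<rho> :: 'k::field)"
  using assms vertex_index_linear[OF assms(1)] by (simp_all add: insert_sign_insert)

text \<open>A chain of the full simplex with vertex set \<open>A\<close> is given by its coefficients \<open>c\<close> on faces; the value is
  the coefficient on \<open>\<tau>\<close> of its (reduced) boundary. Passing to complements \<open>A - \<tau>\<close> turns this boundary
  into the coboundary, which is how the cohomology of \<open>\<Lambda>\<close> enters.\<close>

definition simplex_boundary :: "'p::finite set \<Rightarrow> ('p set \<Rightarrow> 'k::field) \<Rightarrow> 'p set \<Rightarrow> 'k" where
  "simplex_boundary A c \<tau> = (\<Sum>p\<in>A - \<tau>. insert_sign p \<tau> * c (insert p \<tau>))"

text \<open>The diagonal has to vanish explicitly, as antisymmetry alone gives nothing in characteristic \<open>2\<close>.\<close>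

lemma sum_antisymmetric:
  fixes g :: "'a \<Rightarrow> 'a \<Rightarrow> 'k::ab_group_add"
  assumes "finite A" "\<And>x y. x \<in> A \<Longrightarrow> y \<in> A \<Longrightarrow> g x y = - g y x" "\<And>x. x \<in> A \<Longrightarrow> g x x = 0"
  shows "(\<Sum>x\<in>A. \<Sum>y\<in>A. g x y) = 0"
  using assms
proof (induction A rule: finite_induct)
  case (insert a A)
  have "(\<Sum>x\<in>A. g x a) = - (\<Sum>y\<in>A. g a y)"
    unfolding sum_negf[symmetric] by (intro sum.cong insert.prems(1)) auto
  moreover have "(\<Sum>x\<in>A. \<Sum>y\<in>A. g x y) = 0"
    by (intro insert.IH insert.prems) auto
  moreover have "g a a = 0" by (intro insert.prems) auto
  ultimately show ?case using insert.hyps by (simp add: sum.distrib)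
qed simp

lemma simplex_boundary_boundary:
  fixes c :: "'p::finite set \<Rightarrow> 'k::field"
  shows "simplex_boundary A (simplex_boundary A c) \<tau> = 0"
proof -
  define g where "g p q = (if p = q then 0
      else insert_sign p \<tau> * insert_sign q (insert p \<tau>) * c (insert p (insert q \<tau>)))" for p q
  have "simplex_boundary A (simplex_boundary A c) \<tau> = (\<Sum>p\<in>A - \<tau>. \<Sum>q\<in>A - \<tau>. g p q)"
    unfolding simplex_boundary_def sum_distrib_left
  proof (rule sum.cong[OF refl])
    fix p assume "p \<in> A - \<tau>"
    show "(\<Sum>q\<in>A - insert p \<tau>. insert_sign p \<tau> * (insert_sign q (insert p \<tau>) * c (insert q (insert p \<tau>)))) =
        (\<Sum>q\<in>A - \<tau>. g p q)"
      by (rule sum.mono_neutral_cong_left) (auto simp: g_def insert_commute)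
  qed
  also have "\<dots> = 0"
  proof (rule sum_antisymmetric)
    fix p q assume "p \<in> A - \<tau>" "q \<in> A - \<tau>"
    then show "g p q = - g q p"
      using insert_sign_swap(1)[of p q \<tau>, where 'k = 'k] by (cases "p = q") (auto simp: g_def insert_commute)
  qed (auto simp: g_def)
  finally show ?thesis .
qed

text \<open>This is the contraction of a simplex to a vertex \<open>p\<close>, stated at a single face \<open>\<sigma>\<close>: coning the chain
  \<open>c\<close> with \<open>p\<close> gives a chain \<open>g\<close> whose boundary agrees with \<open>c\<close> at \<open>\<sigma>\<close>. Both hypotheses are local. The chain \<open>c\<close>
  has to be a cycle only at \<open>\<sigma> - {p}\<close>, and the vertex \<open>p\<close> may depend on \<open>\<sigma>\<close>, as long as it is the one
  used on all faces \<open>insert q \<sigma>\<close>. Every acyclicity statement below is an instance with a suitable choice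
  of \<open>p\<close>.\<close>

lemma simplex_boundary_cone:
  fixes c g :: "'p::finite set \<Rightarrow> 'k::field"
  assumes p: "p \<in> A"
    and cycle: "p \<in> \<sigma> \<Longrightarrow> simplex_boundary A c (\<sigma> - {p}) = 0"
    and g: "\<And>q. q \<in> A - \<sigma> \<Longrightarrow> g (insert q \<sigma>) =
      (if p \<in> insert q \<sigma> then insert_sign p (insert q \<sigma> - {p}) * c (insert q \<sigma> - {p}) else 0)"
  shows "simplex_boundary A g \<sigma> = c \<sigma>"
proof (cases "p \<in> \<sigma>")
  case False
  have "simplex_boundary A g \<sigma> = (\<Sum>q\<in>A - \<sigma>. if q = p then c \<sigma> else 0)"
    unfolding simplex_boundary_def
    by (rule sum.cong) (use False in \<open>auto simp: g simp flip: mult.assoc\<close>)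
  then show ?thesis using p False by simp
next
  case True
  define \<rho> where "\<rho> = \<sigma> - {p}"
  have \<sigma>: "\<sigma> = insert p \<rho>" "p \<notin> \<rho>" using True by (auto simp: \<rho>_def)
  have "A - \<rho> = insert p (A - \<sigma>)" using p \<sigma> by auto
  then have 0: "insert_sign p \<rho> * c \<sigma> + (\<Sum>q\<in>A - \<sigma>. insert_sign q \<rho> * c (insert q \<rho>)) = 0"
    using cycle[OF True] \<sigma> unfolding \<rho>_def[symmetric] simplex_boundary_def by simp
  have "simplex_boundary A g \<sigma> = (\<Sum>q\<in>A - \<sigma>. - insert_sign p \<rho> * (insert_sign q \<rho> * c (insert q \<rho>)))"
    unfolding simplex_boundary_def
  proof (rule sum.cong[OF refl])
    fix q assume q: "q \<in> A - \<sigma>"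
    then have "insert q \<sigma> - {p} = insert q \<rho>" using \<sigma> by auto
    then have "insert_sign q \<sigma> * g (insert q \<sigma>) =
        (insert_sign q (insert p \<rho>) * insert_sign p (insert q \<rho>)) * c (insert q \<rho>)"
      using g[OF q] True \<sigma> by simp
    also have "\<dots> = - insert_sign p \<rho> * (insert_sign q \<rho> * c (insert q \<rho>))"
      using insert_sign_swap(2)[of p q \<rho>, where 'k = 'k] q \<sigma> by auto
    finally show "insert_sign q \<sigma> * g (insert q \<sigma>) = - insert_sign p \<rho> * (insert_sign q \<rho> * c (insert q \<rho>))" .
  qed
  also have "\<dots> = - insert_sign p \<rho> * (\<Sum>q\<in>A - \<sigma>. insert_sign q \<rho> * c (insert q \<rho>))"
    by (rule sum_distrib_left[symmetric])
  also have "\<dots> = - insert_sign p \<rho> * (- (insert_sign p \<rho> * c \<sigma>))"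
    using 0 by (simp add: add_eq_0_iff)
  also have "\<dots> = c \<sigma>" by (simp flip: mult.assoc)
  finally show ?thesis .
qed

section \<open>Monomials and the Koszul differential\<close>

definition squarefree_mono :: "'p::finite set \<Rightarrow> 'p \<Rightarrow>\<^sub>0 nat" where
  "squarefree_mono \<sigma> = (\<Sum>p\<in>\<sigma>. Poly_Mapping.single p 1)"

lemma lookup_squarefree_mono: "Poly_Mapping.lookup (squarefree_mono \<sigma>) p = (if p \<in> \<sigma> then 1 else 0)"
proof -
  have "Poly_Mapping.lookup (squarefree_mono \<sigma>) p = (\<Sum>q\<in>\<sigma>. if q = p then 1 else 0)"
    unfolding squarefree_mono_def lookup_sum by (rule sum.cong) (auto simp: lookup_single when_def)
  then show ?thesis by simp
qed

lemma lookup_monomial_diff: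
  fixes a b :: "'p \<Rightarrow>\<^sub>0 nat"
  shows "Poly_Mapping.lookup (a - b) p = Poly_Mapping.lookup a p - Poly_Mapping.lookup b p"
  by (simp add: minus_poly_mapping.rep_eq)

lemma keys_squarefree_mono [simp]: "Poly_Mapping.keys (squarefree_mono \<sigma>) = \<sigma>"
  by (auto simp: in_keys_iff lookup_squarefree_mono split: if_splits)

lemma total_degree_squarefree_mono [simp]: "total_degree (squarefree_mono \<sigma>) = card \<sigma>"
  by (simp add: total_degree_def lookup_squarefree_mono flip: sum.inter_filter)

lemma squarefree_mono_empty [simp]: "squarefree_mono {} = 0"
  by (simp add: squarefree_mono_def)

lemma monomial_diff_add:
  "\<sigma> \<subseteq> Poly_Mapping.keys a \<Longrightarrow> a - squarefree_mono \<sigma> + squarefree_mono \<sigma> = a"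
  by (intro poly_mapping_eqI)
    (auto simp: lookup_add lookup_monomial_diff lookup_squarefree_mono in_keys_iff subset_iff)

lemma monomial_add_diff: "m + squarefree_mono \<sigma> - squarefree_mono \<sigma> = m"
  by (intro poly_mapping_eqI) (auto simp: lookup_add lookup_monomial_diff)

lemma keys_add_squarefree_mono:
  "Poly_Mapping.keys (m + squarefree_mono \<sigma>) = Poly_Mapping.keys m \<union> \<sigma>"
  by (auto simp: in_keys_iff lookup_add lookup_squarefree_mono split: if_splits)

lemma lookup_single_mult_add:
  fixes r :: "('p, 'k::field) polyring"
  shows "Poly_Mapping.lookup (Poly_Mapping.single t c * r) (t + m) = c * Poly_Mapping.lookup r m"
  by (simp add: lookup_mult lookup_single when_mult)

lemma lookup_single_mult:
  fixes r :: "('p, 'k::field) polyring"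
  shows "Poly_Mapping.lookup (Poly_Mapping.single (Poly_Mapping.single p 1) c * r) m =
    (if p \<in> Poly_Mapping.keys m then c * Poly_Mapping.lookup r (m - Poly_Mapping.single p 1) else 0)"
proof (cases "p \<in> Poly_Mapping.keys m")
  case True
  then have "m = Poly_Mapping.single p 1 + (m - Poly_Mapping.single p 1)"
    by (intro poly_mapping_eqI) (auto simp: lookup_add lookup_monomial_diff lookup_single when_def in_keys_iff)
  then show ?thesis using lookup_single_mult_add True by metis
next
  case False
  have "m \<notin> Poly_Mapping.keys (Poly_Mapping.single (Poly_Mapping.single p 1) c * r)"
  proof
    assume "m \<in> Poly_Mapping.keys (Poly_Mapping.single (Poly_Mapping.single p 1) c * r)"
    then obtain n where "m = Poly_Mapping.single p 1 + n"
      using keys_mult[of "Poly_Mapping.single (Poly_Mapping.single p 1) c" r]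
      by (auto split: if_splits)
    then show False using False by (simp add: in_keys_iff lookup_add)
  qed
  then show ?thesis using False by (simp add: in_keys_iff)
qed

text \<open>The coefficient of the element \<open>x\<^bsup>a-\<sigma>\<^esup> e\<^sub>\<sigma>\<close>, which has multidegree \<open>a\<close>. For fixed \<open>a\<close> these coefficients form a
  chain of the simplex on the support of \<open>a\<close>, so the Koszul complex splits into chain complexes of
  simplices.\<close>

definition multi_coeff :: "('p::finite, 'k::field) free \<Rightarrow> ('p \<Rightarrow>\<^sub>0 nat) \<Rightarrow> 'p set \<Rightarrow> 'k" where
  "multi_coeff f a \<sigma> = (if \<sigma> \<subseteq> Poly_Mapping.keys a
     then Poly_Mapping.lookup (Poly_Mapping.lookup f (face_index \<sigma>)) (a - squarefree_mono \<sigma>) else 0)"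

text \<open>The differential \<open>e\<^sub>\<sigma> \<mapsto> \<Sum>p\<in>\<sigma>. \<plusminus> x\<^sub>p e\<^bsub>\<sigma>-{p}\<^esub>\<close>, written coordinate by coordinate: the coordinate at \<open>\<tau>\<close> collects
  the contributions of the sets \<open>insert p \<tau>\<close>. The same formula serves in all positions.\<close>

definition koszul_diff :: "('p::finite, 'k::field) free \<Rightarrow> ('p, 'k) free" where
  "koszul_diff f = (\<Sum>\<tau>\<in>UNIV. Poly_Mapping.single (face_index \<tau>)
     (\<Sum>p\<in>- \<tau>. Poly_Mapping.single (Poly_Mapping.single p 1) (insert_sign p \<tau>)
        * Poly_Mapping.lookup f (face_index (insert p \<tau>))))"

definition koszul :: "('p::finite, 'k::field) aug_complex" where
  "koszul = \<lparr>gens = (\<lambda>i. face_index ` {\<sigma> :: 'p set. card \<sigma> = i}), gdeg = (\<lambda>i _. i),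
     diff = (\<lambda>i f. if i = 0 then 0 else koszul_diff f),
     aug = (\<lambda>f. Poly_Mapping.lookup (Poly_Mapping.lookup f (face_index ({} :: 'p set))) 0)\<rparr>"

lemma lookup_sum_face_index:
  "Poly_Mapping.lookup (\<Sum>\<tau>\<in>UNIV. Poly_Mapping.single (face_index \<tau>) (r \<tau>)) (face_index \<sigma>) = r (\<sigma> :: 'p::finite set)"
proof -
  have "Poly_Mapping.lookup (\<Sum>\<tau>\<in>UNIV. Poly_Mapping.single (face_index \<tau>) (r \<tau>)) (face_index \<sigma>) =
      (\<Sum>\<tau>\<in>UNIV. if \<tau> = \<sigma> then r \<sigma> else 0)"
    unfolding lookup_sum by (rule sum.cong) (auto simp: lookup_single when_def)
  then show ?thesis by simp
qed

lemma lookup_sum_face_index_outside: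
  "b \<notin> range (face_index :: 'p::finite set \<Rightarrow> nat) \<Longrightarrow>
    Poly_Mapping.lookup (\<Sum>\<tau>\<in>UNIV. Poly_Mapping.single (face_index (\<tau> :: 'p set)) (r \<tau>)) b = 0"
  unfolding lookup_sum by (intro sum.neutral) (auto simp: lookup_single when_def)

lemma lookup_koszul_diff:
  "Poly_Mapping.lookup (koszul_diff f) (face_index \<tau>) =
     (\<Sum>p\<in>- \<tau>. Poly_Mapping.single (Poly_Mapping.single p 1) (insert_sign p \<tau>)
        * Poly_Mapping.lookup f (face_index (insert p \<tau>)))"
  unfolding koszul_diff_def lookup_sum_face_index ..

lemma lookup_koszul_diff_outside:
  "b \<notin> range (face_index :: 'p::finite set \<Rightarrow> nat) \<Longrightarrow>
    Poly_Mapping.lookup (koszul_diff (f :: ('p, 'k::field) free)) b = 0"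
  unfolding koszul_diff_def by (rule lookup_sum_face_index_outside)

lemma module_hom_koszul_diff: "module_hom rscale rscale koszul_diff"
proof unfold_locales
  fix f g :: "('a::finite, 'b::field) free" and r
  show "koszul_diff (f + g) = koszul_diff f + koszul_diff g"
    unfolding koszul_diff_def lookup_add by (simp add: algebra_simps sum.distrib single_add)
  show "koszul_diff (rscale r f) = rscale r (koszul_diff f)"
  proof (rule poly_mapping_eqI)
    fix b
    show "Poly_Mapping.lookup (koszul_diff (rscale r f)) b = Poly_Mapping.lookup (rscale r (koszul_diff f)) b"
    proof (cases "b \<in> range (face_index :: 'a set \<Rightarrow> nat)")
      case True
      then obtain \<tau> :: "'a set" where "b = face_index \<tau>" by auto
      then show ?thesis
        by (simp only: lookup_koszul_diff lookup_rscale sum_distrib_left mult.left_commute[of _ r])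
    qed (simp add: lookup_koszul_diff_outside)
  qed
qed

lemma multi_coeff_koszul_diff:
  "multi_coeff (koszul_diff f) a \<tau> =
    (if \<tau> \<subseteq> Poly_Mapping.keys a then simplex_boundary (Poly_Mapping.keys a) (multi_coeff f a) \<tau> else 0)"
proof (cases "\<tau> \<subseteq> Poly_Mapping.keys a")
  case True
  let ?m = "a - squarefree_mono \<tau>"
  have keys: "p \<in> Poly_Mapping.keys ?m \<longleftrightarrow> p \<in> Poly_Mapping.keys a" if "p \<notin> \<tau>" for p
    using that by (simp add: in_keys_iff lookup_monomial_diff lookup_squarefree_mono)
  have diff: "?m - Poly_Mapping.single p 1 = a - squarefree_mono (insert p \<tau>)" if "p \<notin> \<tau>" for p
    using that by (intro poly_mapping_eqI)
      (auto simp: lookup_monomial_diff lookup_squarefree_mono lookup_single when_def)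
  have "multi_coeff (koszul_diff f) a \<tau> = (\<Sum>p\<in>- \<tau>. if p \<in> Poly_Mapping.keys a
      then insert_sign p \<tau> * multi_coeff f a (insert p \<tau>) else 0)"
    using True unfolding multi_coeff_def lookup_koszul_diff lookup_sum
    by (auto simp: lookup_single_mult keys diff simp del: One_nat_def intro!: sum.cong)
  also have "\<dots> = (\<Sum>p\<in>Poly_Mapping.keys a - \<tau>. insert_sign p \<tau> * multi_coeff f a (insert p \<tau>))"
    by (rule sum.mono_neutral_cong_right) auto
  finally show ?thesis using True by (simp add: simplex_boundary_def)
qed (simp add: multi_coeff_def)

lemma lookup_conv_multi_coeff:
  "Poly_Mapping.lookup (Poly_Mapping.lookup f (face_index \<sigma>)) m = multi_coeff f (m + squarefree_mono \<sigma>) \<sigma>"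
  by (simp add: multi_coeff_def keys_add_squarefree_mono monomial_add_diff)

lemma free_eqI_multi_coeff:
  fixes f g :: "('p::finite, 'k::field) free"
  assumes "f \<in> free_on (range (face_index :: 'p set \<Rightarrow> nat))" "g \<in> free_on (range (face_index :: 'p set \<Rightarrow> nat))"
    and "\<And>a \<sigma>. \<sigma> \<subseteq> Poly_Mapping.keys a \<Longrightarrow> multi_coeff f a \<sigma> = multi_coeff g a \<sigma>"
  shows "f = g"
proof (rule poly_mapping_eqI)
  fix b
  show "Poly_Mapping.lookup f b = Poly_Mapping.lookup g b"
  proof (cases "b \<in> range (face_index :: 'p set \<Rightarrow> nat)")
    case True
    then obtain \<sigma> :: "'p set" where b: "b = face_index \<sigma>" by auto
    show ?thesis unfolding b
      by (rule poly_mapping_eqI) (simp add: lookup_conv_multi_coeff assms(3) keys_add_squarefree_mono)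
  next
    case False
    then have "b \<notin> Poly_Mapping.keys f" "b \<notin> Poly_Mapping.keys g"
      using assms(1,2) by (auto simp: free_on_def)
    then show ?thesis by (simp add: in_keys_iff)
  qed
qed

text \<open>The cone construction in all multidegrees at once, where \<open>\<pi> a \<sigma>\<close> is the vertex used for the face \<open>\<sigma>\<close> in
  multidegree \<open>a\<close>.\<close>

definition cone :: "(('p::finite \<Rightarrow>\<^sub>0 nat) \<Rightarrow> 'p set \<Rightarrow> 'p) \<Rightarrow> ('p, 'k::field) free \<Rightarrow> ('p, 'k) free" where
  "cone \<pi> f = (\<Sum>\<sigma>\<in>UNIV. Poly_Mapping.single (face_index \<sigma>) (Poly_Mapping.Abs_poly_mapping (\<lambda>m.
     let a = m + squarefree_mono \<sigma>; p = \<pi> a \<sigma>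
     in if p \<in> \<sigma> then insert_sign p (\<sigma> - {p}) * multi_coeff f a (\<sigma> - {p}) else 0)))"

lemma multi_coeff_cone:
  assumes "\<sigma> \<subseteq> Poly_Mapping.keys a"
  shows "multi_coeff (cone \<pi> f) a \<sigma> =
    (if \<pi> a \<sigma> \<in> \<sigma> then insert_sign (\<pi> a \<sigma>) (\<sigma> - {\<pi> a \<sigma>}) * multi_coeff f a (\<sigma> - {\<pi> a \<sigma>}) else 0)"
proof -
  let ?F = "\<lambda>m. let a = m + squarefree_mono \<sigma>; p = \<pi> a \<sigma>
     in if p \<in> \<sigma> then insert_sign p (\<sigma> - {p}) * multi_coeff f a (\<sigma> - {p}) else 0"
  let ?N = "\<lambda>p. (\<lambda>m. m + Poly_Mapping.single p 1) -` Poly_Mapping.keys (Poly_Mapping.lookup f (face_index (\<sigma> - {p})))"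
  have "{m. ?F m \<noteq> 0} \<subseteq> (\<Union>p\<in>\<sigma>. ?N p)"
  proof
    fix m assume "m \<in> {m. ?F m \<noteq> 0}"
    then obtain p where p: "p \<in> \<sigma>" "multi_coeff f (m + squarefree_mono \<sigma>) (\<sigma> - {p}) \<noteq> 0"
      by (auto simp: Let_def split: if_splits)
    have "m + squarefree_mono \<sigma> - squarefree_mono (\<sigma> - {p}) = m + Poly_Mapping.single p 1"
      using p(1) by (intro poly_mapping_eqI)
        (auto simp: lookup_add lookup_monomial_diff lookup_squarefree_mono lookup_single when_def)
    with p show "m \<in> (\<Union>p\<in>\<sigma>. ?N p)"
      by (auto simp: multi_coeff_def in_keys_iff split: if_splits)
  qed
  moreover have "finite (?N p)" for p
    by (rule finite_vimageI) (auto simp: inj_def)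
  ultimately have "finite {m. ?F m \<noteq> 0}" by (meson finite_UN_I finite finite_subset)
  then have "Poly_Mapping.lookup (Poly_Mapping.lookup (cone \<pi> f) (face_index \<sigma>)) m = ?F m" for m
    unfolding cone_def lookup_sum_face_index by (simp only: lookup_Abs_poly_mapping)
  then show ?thesis
    using assms by (simp add: multi_coeff_def[of "cone \<pi> f"] monomial_diff_add Let_def)
qed

lemma cone_outside:
  "b \<notin> range (face_index :: 'p::finite set \<Rightarrow> nat) \<Longrightarrow>
    Poly_Mapping.lookup (cone \<pi> (f :: ('p, 'k::field) free)) b = 0"
  unfolding cone_def by (rule lookup_sum_face_index_outside)

lemma koszul_diff_cone:
  assumes \<sigma>: "\<sigma> \<subseteq> Poly_Mapping.keys a" and p: "p \<in> Poly_Mapping.keys a"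
    and cycle: "p \<in> \<sigma> \<Longrightarrow> multi_coeff (koszul_diff f) a (\<sigma> - {p}) = 0"
    and \<pi>: "\<And>q. q \<in> Poly_Mapping.keys a - \<sigma> \<Longrightarrow> \<pi> a (insert q \<sigma>) = p"
  shows "multi_coeff (koszul_diff (cone \<pi> f)) a \<sigma> = multi_coeff f a \<sigma>"
proof -
  have "simplex_boundary (Poly_Mapping.keys a) (multi_coeff (cone \<pi> f) a) \<sigma> = multi_coeff f a \<sigma>"
  proof (rule simplex_boundary_cone[OF p])
    assume "p \<in> \<sigma>"
    from cycle[OF this] show "simplex_boundary (Poly_Mapping.keys a) (multi_coeff f a) (\<sigma> - {p}) = 0"
      using \<sigma> by (auto simp: multi_coeff_koszul_diff split: if_splits)
  next
    fix q assume q: "q \<in> Poly_Mapping.keys a - \<sigma>"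
    then have "insert q \<sigma> \<subseteq> Poly_Mapping.keys a" using \<sigma> by auto
    from multi_coeff_cone[OF this, of \<pi> f] show "multi_coeff (cone \<pi> f) a (insert q \<sigma>) =
      (if p \<in> insert q \<sigma> then insert_sign p (insert q \<sigma> - {p}) * multi_coeff f a (insert q \<sigma> - {p}) else 0)"
      unfolding \<pi>[OF q] .
  qed
  then show ?thesis using \<sigma> by (simp add: multi_coeff_koszul_diff)
qed

section \<open>The Koszul complex as a resolution\<close>

lemma koszul_sel [simp]:
  "gens (koszul :: ('p::finite, 'k::field) aug_complex) i = face_index ` {\<sigma> :: 'p set. card \<sigma> = i}"
  "gdeg (koszul :: ('p, 'k) aug_complex) = (\<lambda>i _. i)"
  "diff (koszul :: ('p, 'k) aug_complex) (Suc i) = koszul_diff"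
  "diff (koszul :: ('p, 'k) aug_complex) 0 = (\<lambda>_. 0)"
  "aug (koszul :: ('p, 'k) aug_complex) f =
     Poly_Mapping.lookup (Poly_Mapping.lookup f (face_index ({} :: 'p set))) 0"
  by (auto simp: koszul_def)

abbreviation koszul_free :: "nat \<Rightarrow> ('p::finite, 'k::field) free set" where
  "koszul_free i \<equiv> free_on (face_index ` {\<sigma> :: 'p set. card \<sigma> = i})"

lemma koszul_freeI:
  fixes f :: "('p::finite, 'k::field) free"
  assumes "\<And>b. b \<notin> range (face_index :: 'p set \<Rightarrow> nat) \<Longrightarrow> Poly_Mapping.lookup f b = 0"
    and "\<And>a \<sigma>. \<sigma> \<subseteq> Poly_Mapping.keys a \<Longrightarrow> multi_coeff f a \<sigma> \<noteq> 0 \<Longrightarrow> card \<sigma> = i"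
  shows "f \<in> koszul_free i"
  unfolding free_on_def
proof (intro CollectI subsetI)
  fix b assume "b \<in> Poly_Mapping.keys f"
  then have nz: "Poly_Mapping.lookup f b \<noteq> 0" by (simp add: in_keys_iff)
  then obtain \<sigma> :: "'p set" where b: "b = face_index \<sigma>" using assms(1) by blast
  obtain m where "Poly_Mapping.lookup (Poly_Mapping.lookup f b) m \<noteq> 0"
    using nz by (metis lookup_zero poly_mapping_eqI)
  then have "multi_coeff f (m + squarefree_mono \<sigma>) \<sigma> \<noteq> 0"
    by (simp add: b lookup_conv_multi_coeff)
  then have "card \<sigma> = i" by (intro assms(2)) (auto simp: keys_add_squarefree_mono)
  then show "b \<in> face_index ` {\<sigma> :: 'p set. card \<sigma> = i}" using b by blast
qed

lemma koszul_free_range: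
  fixes f :: "('p::finite, 'k::field) free"
  assumes "f \<in> koszul_free i"
  shows "f \<in> free_on (range (face_index :: 'p set \<Rightarrow> nat))"
  using assms by (auto simp: free_on_def)

lemma multi_coeff_koszul_free:
  fixes f :: "('p::finite, 'k::field) free"
  assumes "f \<in> koszul_free i" "card \<sigma> \<noteq> i"
  shows "multi_coeff f a \<sigma> = 0"
proof -
  have "face_index \<sigma> \<notin> Poly_Mapping.keys f" using assms by (auto simp: free_on_def)
  then show ?thesis by (simp add: multi_coeff_def in_keys_iff)
qed

lemma koszul_diff_free:
  fixes f :: "('p::finite, 'k::field) free"
  assumes f: "f \<in> koszul_free (Suc i)"
  shows "koszul_diff f \<in> koszul_free i"
proof (rule koszul_freeI)
  fix a :: "'p \<Rightarrow>\<^sub>0 nat" and \<tau> assume "\<tau> \<subseteq> Poly_Mapping.keys a" "multi_coeff (koszul_diff f) a \<tau> \<noteq> 0"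
  then have "(\<Sum>p\<in>Poly_Mapping.keys a - \<tau>. insert_sign p \<tau> * multi_coeff f a (insert p \<tau>)) \<noteq> 0"
    by (simp add: multi_coeff_koszul_diff simplex_boundary_def)
  then obtain p where "p \<in> Poly_Mapping.keys a - \<tau>" "multi_coeff f a (insert p \<tau>) \<noteq> 0"
    using sum.neutral by (metis (no_types, lifting) mult_zero_right)
  then show "card \<tau> = i" using multi_coeff_koszul_free[OF f, of "insert p \<tau>" a] by auto
qed (rule lookup_koszul_diff_outside)

lemma cone_free:
  fixes f :: "('p::finite, 'k::field) free"
  assumes f: "f \<in> koszul_free i"
  shows "cone \<pi> f \<in> koszul_free (Suc i)"
proof (rule koszul_freeI)
  fix a :: "'p \<Rightarrow>\<^sub>0 nat" and \<sigma> assume "\<sigma> \<subseteq> Poly_Mapping.keys a" "multi_coeff (cone \<pi> f) a \<sigma> \<noteq> 0"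
  then obtain p where "p \<in> \<sigma>" "multi_coeff f a (\<sigma> - {p}) \<noteq> 0"
    by (auto simp: multi_coeff_cone split: if_splits)
  then show "card \<sigma> = Suc i"
    using multi_coeff_koszul_free[OF f, of "\<sigma> - {p}" a] card_Suc_Diff1[of \<sigma> p] by fastforce
qed (rule cone_outside)

text \<open>In each multidegree this is the vanishing of the twofold boundary in a simplex.\<close>

lemma koszul_diff_koszul_diff: "koszul_diff (koszul_diff (f :: ('p::finite, 'k::field) free)) = 0"
proof (rule free_eqI_multi_coeff)
  show "koszul_diff (koszul_diff f) \<in> free_on (range (face_index :: 'p set \<Rightarrow> nat))"
    using lookup_koszul_diff_outside[of _ "koszul_diff f"] by (auto simp: free_on_def in_keys_iff)
  show "0 \<in> free_on (range (face_index :: 'p set \<Rightarrow> nat))" by (simp add: free_on_def)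
  fix a :: "'p \<Rightarrow>\<^sub>0 nat" and \<sigma> assume \<sigma>: "\<sigma> \<subseteq> Poly_Mapping.keys a"
  have "simplex_boundary (Poly_Mapping.keys a) (multi_coeff (koszul_diff f) a) \<sigma> =
      simplex_boundary (Poly_Mapping.keys a) (simplex_boundary (Poly_Mapping.keys a) (multi_coeff f a)) \<sigma>"
    unfolding simplex_boundary_def[of _ "multi_coeff (koszul_diff f) a"]
      simplex_boundary_def[of _ "simplex_boundary _ _"]
    using \<sigma> by (intro sum.cong) (auto simp: multi_coeff_koszul_diff)
  then show "multi_coeff (koszul_diff (koszul_diff f)) a \<sigma> = multi_coeff 0 a \<sigma>"
    using \<sigma> by (simp add: multi_coeff_koszul_diff[of "koszul_diff f"] simplex_boundary_boundary)
      (simp add: multi_coeff_def)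
qed

lemma homogeneous_koszul_iff:
  fixes f :: "('p::finite, 'k::field) free"
  assumes "f \<in> koszul_free i"
  shows "f \<in> homogeneous (\<lambda>_. i) j \<longleftrightarrow>
    (\<forall>a \<sigma>. multi_coeff f a \<sigma> \<noteq> 0 \<longrightarrow> total_degree a = j)"
proof
  assume f: "f \<in> homogeneous (\<lambda>_. i) j"
  show "\<forall>a \<sigma>. multi_coeff f a \<sigma> \<noteq> 0 \<longrightarrow> total_degree a = j"
  proof (intro allI impI)
    fix a \<sigma> assume nz: "multi_coeff f a \<sigma> \<noteq> 0"
    then have \<sigma>: "\<sigma> \<subseteq> Poly_Mapping.keys a" by (auto simp: multi_coeff_def split: if_splits)
    have "card \<sigma> = i" using nz multi_coeff_koszul_free[OF assms] by blast
    moreover have "total_degree (a - squarefree_mono \<sigma>) + i = j"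
      using nz \<sigma> by (intro homogeneousD[OF f]) (simp add: multi_coeff_def in_keys_iff)
    moreover have "total_degree a = total_degree (a - squarefree_mono \<sigma>) + card \<sigma>"
      by (subst monomial_diff_add[OF \<sigma>, symmetric])
        (simp only: total_degree_add total_degree_squarefree_mono)
    ultimately show "total_degree a = j" by simp
  qed
next
  assume *: "\<forall>a \<sigma>. multi_coeff f a \<sigma> \<noteq> 0 \<longrightarrow> total_degree a = j"
  show "f \<in> homogeneous (\<lambda>_. i) j"
    unfolding homogeneous_def
  proof (intro CollectI allI ballI)
    fix b m assume m: "m \<in> Poly_Mapping.keys (Poly_Mapping.lookup f b)"
    then have "b \<in> Poly_Mapping.keys f" by (auto simp: in_keys_iff)
    then obtain \<sigma> :: "'p set" where b: "b = face_index \<sigma>" "card \<sigma> = i"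
      using assms by (auto simp: free_on_def)
    have "multi_coeff f (m + squarefree_mono \<sigma>) \<sigma> \<noteq> 0"
      using m by (simp add: b in_keys_iff lookup_conv_multi_coeff)
    with * b show "total_degree m + i = j" by fastforce
  qed
qed

lemma koszul_diff_homogeneous:
  fixes f :: "('p::finite, 'k::field) free"
  assumes f: "f \<in> koszul_free (Suc i)" and hom: "f \<in> homogeneous (\<lambda>_. Suc i) j"
  shows "koszul_diff f \<in> homogeneous (\<lambda>_. i) j"
  unfolding homogeneous_koszul_iff[OF koszul_diff_free[OF f]]
proof (intro allI impI)
  fix a \<tau> assume "multi_coeff (koszul_diff f) a \<tau> \<noteq> 0"
  then have "(\<Sum>p\<in>Poly_Mapping.keys a - \<tau>. insert_sign p \<tau> * multi_coeff f a (insert p \<tau>)) \<noteq> 0"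
    by (simp add: multi_coeff_koszul_diff simplex_boundary_def split: if_splits)
  then obtain p where "multi_coeff f a (insert p \<tau>) \<noteq> 0"
    using sum.neutral by (metis (no_types, lifting) mult_zero_right)
  then show "total_degree a = j" using hom homogeneous_koszul_iff[OF f] by blast
qed

lemma lookup_mult_0:
  fixes r s :: "('p, 'k::field) polyring"
  shows "Poly_Mapping.lookup (r * s) 0 = Poly_Mapping.lookup r 0 * Poly_Mapping.lookup s 0"
proof -
  have 0: "0 = l + q \<longleftrightarrow> l = 0 \<and> q = 0" for l q :: "'p \<Rightarrow>\<^sub>0 nat"
    by (auto simp: poly_mapping_eq_iff fun_eq_iff lookup_add)
  have "(Sum_any (\<lambda>q. Poly_Mapping.lookup s q when 0 = l + q)) = (Poly_Mapping.lookup s 0 when l = 0)" for l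
    by (cases "l = 0") (simp_all add: 0)
  then show ?thesis by (simp add: lookup_mult mult_when)
qed

text \<open>A choice function; any choice of vertices would do for the constructions below.\<close>

definition pick :: "'a set \<Rightarrow> 'a" where
  "pick A = (SOME x. x \<in> A)"

lemma pick_in: "A \<noteq> {} \<Longrightarrow> pick A \<in> A"
  unfolding pick_def by (simp add: some_in_eq)

text \<open>In a nonzero multidegree the simplex on the support is nonempty and can be contracted to one of its
  vertices. In multidegree \<open>0\<close> only the coefficient at \<open>{}\<close> survives, which is zero unless \<open>i = 0\<close>, when it is the
  value of the augmentation.\<close>

lemma koszul_exact:
  fixes f :: "('p::finite, 'k::field) free"
  assumes f: "f \<in> koszul_free i" and cycle: "koszul_diff f = 0"
    and aug: "i = 0 \<Longrightarrow> Poly_Mapping.lookup (Poly_Mapping.lookup f (face_index ({} :: 'p set))) 0 = 0"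
  shows "f \<in> koszul_diff ` koszul_free (Suc i)"
proof
  \<comment> \<open>The vertex depends only on the multidegree, so the coherence condition for cones is automatic.\<close>
  let ?\<pi> = "\<lambda>a _. pick (Poly_Mapping.keys a)"
  show "cone ?\<pi> f \<in> koszul_free (Suc i)" using cone_free[OF f] .
  show "f = koszul_diff (cone ?\<pi> f)"
  proof (rule free_eqI_multi_coeff)
    show "f \<in> free_on (range (face_index :: 'p set \<Rightarrow> nat))" using f by (rule koszul_free_range)
    show "koszul_diff (cone ?\<pi> f) \<in> free_on (range (face_index :: 'p set \<Rightarrow> nat))"
      using koszul_diff_free[OF cone_free[OF f]] by (rule koszul_free_range)
    fix a :: "'p \<Rightarrow>\<^sub>0 nat" and \<sigma> assume \<sigma>: "\<sigma> \<subseteq> Poly_Mapping.keys a"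
    show "multi_coeff f a \<sigma> = multi_coeff (koszul_diff (cone ?\<pi> f)) a \<sigma>"
    proof (cases "Poly_Mapping.keys a = {}")
      case True
      then have "a = 0" by (simp add: poly_mapping_eq_iff fun_eq_iff in_keys_iff set_eq_iff)
      have "multi_coeff f a {} = 0"
        using aug multi_coeff_koszul_free[OF f, of "{}" a] \<open>a = 0\<close>
        by (cases "i = 0") (auto simp: multi_coeff_def)
      then show ?thesis using True \<sigma> by (simp add: multi_coeff_koszul_diff simplex_boundary_def)
    next
      case False
      then have "pick (Poly_Mapping.keys a) \<in> Poly_Mapping.keys a" by (rule pick_in)
      from koszul_diff_cone[OF \<sigma> this, of f ?\<pi>] show ?thesis
        by (simp add: cycle) (simp add: multi_coeff_def)
    qed
  qed
qed

lemma koszul_resolution: "graded_free_resolution (koszul :: ('p::finite, 'k::field) aug_complex)"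
proof -
  let ?e = "face_index ({} :: 'p set)"
  let ?aug = "\<lambda>f :: ('p, 'k) free. Poly_Mapping.lookup (Poly_Mapping.lookup f ?e) 0"
  have zero: "module_hom rscale rscale (\<lambda>_ :: ('p, 'k) free. 0 :: ('p, 'k) free)"
    by unfold_locales auto
  have 1: "module_hom rscale rscale (diff (koszul :: ('p, 'k) aug_complex) i)" for i
    by (cases i) (simp_all add: zero module_hom_koszul_diff)
  have "module (residue_scale :: ('p, 'k) polyring \<Rightarrow> 'k \<Rightarrow> 'k)"
    by (rule module.intro) (simp_all add: residue_scale_def lookup_add lookup_mult_0 ring_distribs mult.assoc)
  then have 2: "module_hom rscale residue_scale (aug (koszul :: ('p, 'k) aug_complex))"
    unfolding module_hom_iff by (intro conjI module_rscale) (simp_all add: residue_scale_def lookup_add lookup_mult_0)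
  have 3: "?aug ` koszul_free 0 = UNIV"
  proof -
    have "c \<in> ?aug ` koszul_free 0" for c
      by (rule image_eqI[of _ _ "Poly_Mapping.single ?e (Poly_Mapping.single 0 c)"])
        (auto simp: free_on_def split: if_splits)
    then show ?thesis by auto
  qed
  have 4: "?aug f = 0" if "f \<in> homogeneous (\<lambda>_. 0) j" "j \<noteq> 0" for f j
    using that homogeneousD[OF that(1), of 0 ?e] by (auto simp: in_keys_iff)
  have 5: "{f \<in> koszul_free 0. ?aug f = 0} = koszul_diff ` koszul_free (Suc 0)"
  proof (intro equalityI subsetI)
    fix f :: "('p, 'k) free" assume "f \<in> {f \<in> koszul_free 0. ?aug f = 0}"
    then have f: "f \<in> koszul_free 0" "?aug f = 0" by auto
    have "koszul_diff f = 0"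
    proof (rule free_eqI_multi_coeff)
      show "koszul_diff f \<in> free_on (range (face_index :: 'p set \<Rightarrow> nat))"
        using lookup_koszul_diff_outside[of _ f] by (auto simp: free_on_def in_keys_iff)
      show "0 \<in> free_on (range (face_index :: 'p set \<Rightarrow> nat))" by (simp add: free_on_def)
      show "multi_coeff (koszul_diff f) a \<sigma> = multi_coeff 0 a \<sigma>" for a \<sigma>
        using multi_coeff_koszul_free[OF f(1)]
        by (simp add: multi_coeff_koszul_diff simplex_boundary_def) (simp add: multi_coeff_def)
    qed
    then show "f \<in> koszul_diff ` koszul_free (Suc 0)" using koszul_exact[OF f(1)] f(2) by simp
  next
    fix f :: "('p, 'k) free" assume "f \<in> koszul_diff ` koszul_free (Suc 0)"
    then obtain g where g: "g \<in> koszul_free (Suc 0)" "f = koszul_diff g" by blast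
    have "?aug f = multi_coeff f 0 {}" by (simp add: multi_coeff_def)
    also have "\<dots> = 0" unfolding g(2) by (simp add: multi_coeff_koszul_diff simplex_boundary_def)
    finally show "f \<in> {f \<in> koszul_free 0. ?aug f = 0}" using koszul_diff_free[OF g(1)] g(2) by simp
  qed
  have 6: "{f \<in> (koszul_free (Suc i) :: ('p, 'k) free set). koszul_diff f = 0} = koszul_diff ` koszul_free (Suc (Suc i))" for i
    using koszul_exact[of _ "Suc i"] koszul_diff_free koszul_diff_koszul_diff by auto
  show ?thesis
    unfolding graded_free_resolution_def
  proof (intro conjI allI impI)
    fix i :: nat assume "1 \<le> i"
    let ?K = "koszul :: ('p, 'k) aug_complex"
    show "{f \<in> free_on (gens ?K i). diff ?K i f = 0} = diff ?K (Suc i) ` free_on (gens ?K (Suc i))"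
      using \<open>1 \<le> i\<close> 6[of "i - 1"] by (cases i) auto
  qed (use 1 2 3 4 5 koszul_diff_free koszul_diff_homogeneous in \<open>auto simp: image_subset_iff\<close>)
qed

section \<open>Stanley-Reisner ideals and the Koszul complex\<close>

lemma prod_var: "(\<Prod>p\<in>\<sigma>. var p :: ('p::finite, 'k::field) polyring) = Poly_Mapping.single (squarefree_mono \<sigma>) 1"
proof (induction \<sigma> rule: finite_induct[OF finite])
  case (2 p \<sigma>)
  then have "squarefree_mono (insert p \<sigma>) = Poly_Mapping.single p 1 + squarefree_mono \<sigma>"
    by (simp add: squarefree_mono_def)
  with 2 show ?case by (simp add: var_def mult_single)
qed simp

text \<open>The elements whose monomials all have nonface support form an ideal because the complex is closed
  under subsets, and each such monomial is a multiple of the squarefree monomial of its support.\<close>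

lemma stanley_reisner_ideal_iff:
  fixes f :: "('p::finite, 'k::field) polyring"
  assumes down: "\<forall>\<sigma>\<in>\<Delta>. Pow \<sigma> \<subseteq> \<Delta>"
  shows "f \<in> stanley_reisner_ideal \<Delta> \<longleftrightarrow>
    (\<forall>m. Poly_Mapping.keys m \<in> \<Delta> \<longrightarrow> Poly_Mapping.lookup f m = 0)"
proof
  let ?S = "{f :: ('p, 'k) polyring. \<forall>m. Poly_Mapping.keys m \<in> \<Delta> \<longrightarrow> Poly_Mapping.lookup f m = 0}"
  have "ideals.subspace ?S"
  proof (rule ideals.subspaceI)
    fix r f :: "('p, 'k) polyring" assume f: "f \<in> ?S"
    show "r * f \<in> ?S"
    proof (intro CollectI allI impI)
      fix m :: "'p \<Rightarrow>\<^sub>0 nat" assume m: "Poly_Mapping.keys m \<in> \<Delta>"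
      show "Poly_Mapping.lookup (r * f) m = 0"
      proof (rule ccontr)
        assume "Poly_Mapping.lookup (r * f) m \<noteq> 0"
        then have "m \<in> Poly_Mapping.keys (r * f)" by (simp add: in_keys_iff)
        then obtain u v where uv: "m = u + v" "v \<in> Poly_Mapping.keys f"
          using keys_mult by blast
        have "Poly_Mapping.keys v \<subseteq> Poly_Mapping.keys m"
          by (auto simp: uv(1) in_keys_iff lookup_add)
        then have "Poly_Mapping.keys v \<in> \<Delta>" using down m by blast
        then show False using f uv(2) by (auto simp: in_keys_iff)
      qed
    qed
  qed (auto simp: lookup_add)
  moreover have "{\<Prod>p\<in>\<sigma>. var p | \<sigma>. \<sigma> \<notin> \<Delta>} \<subseteq> ?S"
    by (auto simp: prod_var lookup_single when_def)
  ultimately have "stanley_reisner_ideal \<Delta> \<subseteq> ?S"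
    unfolding stanley_reisner_ideal_def by (rule ideals.span_minimal[rotated])
  then show "f \<in> stanley_reisner_ideal \<Delta> \<Longrightarrow>
      \<forall>m. Poly_Mapping.keys m \<in> \<Delta> \<longrightarrow> Poly_Mapping.lookup f m = 0" by blast
next
  assume f: "\<forall>m. Poly_Mapping.keys m \<in> \<Delta> \<longrightarrow> Poly_Mapping.lookup f m = 0"
  have "f = (\<Sum>m\<in>Poly_Mapping.keys f. Poly_Mapping.single m (Poly_Mapping.lookup f m))"
  proof (rule poly_mapping_eqI)
    fix n
    have "(\<Sum>m\<in>Poly_Mapping.keys f. Poly_Mapping.lookup (Poly_Mapping.single m (Poly_Mapping.lookup f m)) n) =
        (\<Sum>m\<in>Poly_Mapping.keys f. if m = n then Poly_Mapping.lookup f n else 0)"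
      by (rule sum.cong) (auto simp: lookup_single)
    then show "Poly_Mapping.lookup f n =
        Poly_Mapping.lookup (\<Sum>m\<in>Poly_Mapping.keys f. Poly_Mapping.single m (Poly_Mapping.lookup f m)) n"
      by (simp add: lookup_sum in_keys_iff)
  qed
  moreover have "Poly_Mapping.single m (Poly_Mapping.lookup f m) \<in> stanley_reisner_ideal \<Delta>"
    if "m \<in> Poly_Mapping.keys f" for m
  proof -
    have "Poly_Mapping.keys m \<notin> \<Delta>" using f that by (auto simp: in_keys_iff)
    then have "Poly_Mapping.single (squarefree_mono (Poly_Mapping.keys m)) 1 \<in> stanley_reisner_ideal \<Delta>"
      unfolding stanley_reisner_ideal_def by (intro ideals.span_base) (auto simp: prod_var)
    then have "Poly_Mapping.single (m - squarefree_mono (Poly_Mapping.keys m)) (Poly_Mapping.lookup f m) *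
        Poly_Mapping.single (squarefree_mono (Poly_Mapping.keys m)) 1 \<in> stanley_reisner_ideal \<Delta>"
      unfolding stanley_reisner_ideal_def by (rule ideals.span_scale)
    then show ?thesis by (simp add: mult_single monomial_diff_add)
  qed
  ultimately show "f \<in> stanley_reisner_ideal \<Delta>"
    unfolding stanley_reisner_ideal_def by (metis (no_types, lifting) ideals.span_sum)
qed

lemma subspace_stanley_reisner_ideal: "module.subspace (*) (stanley_reisner_ideal \<Delta>)"
  unfolding stanley_reisner_ideal_def by (rule ideals.subspace_span)

text \<open>Modulo the ideal, the coefficient at \<open>\<sigma>\<close> in multidegree \<open>a\<close> survives exactly when the support of \<open>a - \<sigma>\<close> is a
  face.\<close>

lemma coordinates_in_stanley_reisner_iff:
  fixes f :: "('p::finite, 'k::field) free"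
  assumes down: "\<forall>\<sigma>\<in>\<Delta>. Pow \<sigma> \<subseteq> \<Delta>"
    and f: "f \<in> free_on (range (face_index :: 'p set \<Rightarrow> nat))"
  shows "(\<forall>b. Poly_Mapping.lookup f b \<in> stanley_reisner_ideal \<Delta>) \<longleftrightarrow>
    (\<forall>a \<sigma>. \<sigma> \<subseteq> Poly_Mapping.keys a \<longrightarrow> Poly_Mapping.keys (a - squarefree_mono \<sigma>) \<in> \<Delta> \<longrightarrow>
      multi_coeff f a \<sigma> = 0)"
proof (intro iffI allI impI)
  fix a \<sigma> assume *: "\<forall>b. Poly_Mapping.lookup f b \<in> stanley_reisner_ideal \<Delta>"
    and "\<sigma> \<subseteq> Poly_Mapping.keys a" "Poly_Mapping.keys (a - squarefree_mono \<sigma>) \<in> \<Delta>"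
  moreover have "Poly_Mapping.lookup f (face_index \<sigma>) \<in> stanley_reisner_ideal \<Delta>" using * by blast
  ultimately show "multi_coeff f a \<sigma> = 0"
    unfolding stanley_reisner_ideal_iff[OF down] by (simp add: multi_coeff_def)
next
  fix b assume *: "\<forall>a \<sigma>. \<sigma> \<subseteq> Poly_Mapping.keys a \<longrightarrow> Poly_Mapping.keys (a - squarefree_mono \<sigma>) \<in> \<Delta> \<longrightarrow>
      multi_coeff f a \<sigma> = 0"
  show "Poly_Mapping.lookup f b \<in> stanley_reisner_ideal \<Delta>"
  proof (cases "b \<in> range (face_index :: 'p set \<Rightarrow> nat)")
    case True
    then obtain \<sigma> :: "'p set" where b: "b = face_index \<sigma>" by auto
    show ?thesis
      unfolding stanley_reisner_ideal_iff[OF down] b lookup_conv_multi_coeff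
      using * by (simp add: keys_add_squarefree_mono monomial_add_diff)
  next
    case False
    then have "Poly_Mapping.lookup f b = 0" using f by (auto simp: free_on_def in_keys_iff)
    then show ?thesis using ideals.subspace_0[OF subspace_stanley_reisner_ideal] by simp
  qed
qed

lemma koszul_tor_cycles_iff:
  fixes f :: "('p::finite, 'k::field) free"
  assumes down: "\<forall>\<sigma>\<in>\<Delta>. Pow \<sigma> \<subseteq> \<Delta>"
  shows "f \<in> tor_cycles koszul (stanley_reisner_ideal \<Delta>) (Suc i) \<longleftrightarrow>
    f \<in> koszul_free (Suc i) \<and>
    (\<forall>a \<tau>. \<tau> \<subseteq> Poly_Mapping.keys a \<longrightarrow> Poly_Mapping.keys (a - squarefree_mono \<tau>) \<in> \<Delta> \<longrightarrow>
      multi_coeff (koszul_diff f) a \<tau> = 0)"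
  using coordinates_in_stanley_reisner_iff[OF down koszul_free_range[OF koszul_diff_free]]
  by (auto simp: tor_cycles_def)

lemma multi_coeff_add: "multi_coeff (f + g) a \<sigma> = multi_coeff f a \<sigma> + multi_coeff g a \<sigma>"
  by (simp add: multi_coeff_def lookup_add)

lemma multi_coeff_diff: "multi_coeff (f - g) a \<sigma> = multi_coeff f a \<sigma> - multi_coeff g a \<sigma>"
  by (simp add: multi_coeff_def lookup_minus)

lemma multi_coeff_kscale: "multi_coeff (kscale c f) a \<sigma> = c * multi_coeff f a \<sigma>"
  by (simp add: multi_coeff_def kscale_def flip: mult_map_scale_conv_mult)
    (simp add: Poly_Mapping.map.rep_eq when_def)

lemma koszul_tor_boundaries_iff:
  fixes f :: "('p::finite, 'k::field) free"
  assumes down: "\<forall>\<sigma>\<in>\<Delta>. Pow \<sigma> \<subseteq> \<Delta>"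
  shows "f \<in> tor_boundaries koszul (stanley_reisner_ideal \<Delta>) i \<longleftrightarrow>
    f \<in> koszul_free i \<and> (\<exists>g\<in>koszul_free (Suc i).
    \<forall>a \<sigma>. \<sigma> \<subseteq> Poly_Mapping.keys a \<longrightarrow> Poly_Mapping.keys (a - squarefree_mono \<sigma>) \<in> \<Delta> \<longrightarrow>
      multi_coeff f a \<sigma> = multi_coeff (koszul_diff g) a \<sigma>)"
proof -
  have "f \<in> tor_boundaries koszul (stanley_reisner_ideal \<Delta>) i \<longleftrightarrow>
    (\<exists>g\<in>koszul_free (Suc i). f - koszul_diff g \<in> koszul_free i \<and>
      (\<forall>b. Poly_Mapping.lookup (f - koszul_diff g) b \<in> stanley_reisner_ideal \<Delta>))"
    (is "_ \<longleftrightarrow> ?R")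
  proof
    assume ?R
    then obtain g where g: "g \<in> koszul_free (Suc i)" "f - koszul_diff g \<in> koszul_free i"
      "\<And>b. Poly_Mapping.lookup (f - koszul_diff g) b \<in> stanley_reisner_ideal \<Delta>" by blast
    moreover have "f = koszul_diff g + (f - koszul_diff g)" by simp
    ultimately show "f \<in> tor_boundaries koszul (stanley_reisner_ideal \<Delta>) i"
      unfolding tor_boundaries_def ideal_times_free_def koszul_sel by blast
  next
    assume "f \<in> tor_boundaries koszul (stanley_reisner_ideal \<Delta>) i"
    then obtain g h where "f = koszul_diff g + h" "g \<in> koszul_free (Suc i)" "h \<in> koszul_free i"
      "\<And>b. Poly_Mapping.lookup h b \<in> stanley_reisner_ideal \<Delta>"
      by (auto simp: tor_boundaries_def ideal_times_free_def)
    then show ?R by (intro bexI[of _ g]) auto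
  qed
  also have "\<dots> \<longleftrightarrow> (\<exists>g\<in>koszul_free (Suc i). f \<in> koszul_free i \<and>
      (\<forall>a \<sigma>. \<sigma> \<subseteq> Poly_Mapping.keys a \<longrightarrow> Poly_Mapping.keys (a - squarefree_mono \<sigma>) \<in> \<Delta> \<longrightarrow>
      multi_coeff f a \<sigma> = multi_coeff (koszul_diff g) a \<sigma>))"
  proof (intro bex_cong refl)
    fix g :: "('p, 'k) free" assume g: "g \<in> koszul_free (Suc i)"
    have "f - koszul_diff g \<in> koszul_free i \<longleftrightarrow> f \<in> koszul_free i"
      using rmod.subspace_add[OF subspace_free_on] rmod.subspace_diff[OF subspace_free_on]
        koszul_diff_free[OF g] by (metis diff_add_cancel)
    moreover have "(\<forall>b. Poly_Mapping.lookup (f - koszul_diff g) b \<in> stanley_reisner_ideal \<Delta>) \<longleftrightarrow>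
      (\<forall>a \<sigma>. \<sigma> \<subseteq> Poly_Mapping.keys a \<longrightarrow> Poly_Mapping.keys (a - squarefree_mono \<sigma>) \<in> \<Delta> \<longrightarrow>
        multi_coeff f a \<sigma> = multi_coeff (koszul_diff g) a \<sigma>)" if "f - koszul_diff g \<in> koszul_free i"
      using coordinates_in_stanley_reisner_iff[OF down koszul_free_range[OF that]]
      by (simp add: multi_coeff_diff)
    ultimately show "f - koszul_diff g \<in> koszul_free i \<and>
      (\<forall>b. Poly_Mapping.lookup (f - koszul_diff g) b \<in> stanley_reisner_ideal \<Delta>) \<longleftrightarrow> f \<in> koszul_free i \<and>
      (\<forall>a \<sigma>. \<sigma> \<subseteq> Poly_Mapping.keys a \<longrightarrow> Poly_Mapping.keys (a - squarefree_mono \<sigma>) \<in> \<Delta> \<longrightarrow>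
        multi_coeff f a \<sigma> = multi_coeff (koszul_diff g) a \<sigma>)"
      by blast
  qed
  finally show ?thesis by blast
qed

section \<open>A basis of Tor for linear spaces\<close>

lemma incidence_complex_down: "\<forall>\<sigma>\<in>incidence_complex L. Pow \<sigma> \<subseteq> incidence_complex L"
  by (auto simp: incidence_complex_def)

lemma incidence_complexI: "l \<in> L \<Longrightarrow> \<sigma> \<subseteq> l \<Longrightarrow> \<sigma> \<in> incidence_complex L"
  by (auto simp: incidence_complex_def)

lemma multi_coeff_sum: "multi_coeff (sum f A) a \<sigma> = (\<Sum>x\<in>A. multi_coeff (f x) a \<sigma>)"
  by (simp add: multi_coeff_def lookup_sum)

lemma multi_coeff_single:
  "multi_coeff (Poly_Mapping.single (face_index \<tau>) (Poly_Mapping.single m c)) a \<sigma> =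
    (if \<sigma> = \<tau> \<and> a = m + squarefree_mono \<tau> then c else 0)"
proof -
  have "m = a - squarefree_mono \<tau> \<longleftrightarrow> a = m + squarefree_mono \<tau>" if "\<tau> \<subseteq> Poly_Mapping.keys a"
    using monomial_diff_add[OF that] monomial_add_diff[of m \<tau>] by metis
  then show ?thesis
    by (auto simp: multi_coeff_def lookup_single when_def keys_add_squarefree_mono)
qed

lemma squarefree_mono_inject [simp]: "squarefree_mono \<sigma> = squarefree_mono \<tau> \<longleftrightarrow> \<sigma> = \<tau>"
  by (metis keys_squarefree_mono)

lemma squarefree_mono_diff_add: "\<tau> \<subseteq> W \<Longrightarrow> squarefree_mono (W - \<tau>) + squarefree_mono \<tau> = squarefree_mono W"
  by (intro poly_mapping_eqI) (auto simp: lookup_add lookup_squarefree_mono)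

lemma keys_squarefree_mono_diff: "Poly_Mapping.keys (squarefree_mono W - squarefree_mono \<sigma>) = W - \<sigma>"
  by (auto simp: in_keys_iff lookup_monomial_diff lookup_squarefree_mono split: if_splits)

text \<open>The index set of a basis of the Tor module in multidegrees of size \<open>j\<close>. In the squarefree multidegree
  \<open>W\<close>, Tor is the first cohomology of the restriction of \<open>\<Lambda>\<close> to \<open>W\<close>. On each line \<open>l\<close>, a cocycle is the
  coboundary of a function on \<open>l \<inter> W\<close>, unique up to a constant, hence described by its values on \<open>l \<inter> W\<close> with
  one base point removed. A global coboundary can be subtracted so that the cocycle vanishes on all
  lines through \<open>pick W\<close>, and this normalization uses up the freedom. A basis is
  therefore indexed by the lines off \<open>pick W\<close> with a non-base point on each.\<close>

definition tor_index :: "'p::finite set set \<Rightarrow> nat \<Rightarrow> ('p set \<times> 'p set \<times> 'p) set" where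
  "tor_index L j = (SIGMA W:{W. card W = j}. SIGMA l:{l \<in> L. pick W \<notin> l}. l \<inter> W - {pick (l \<inter> W)})"

text \<open>The coboundary of the indicator function of \<open>y\<close>, restricted to the edges on the line \<open>l\<close>. The edge
  \<open>{y, z}\<close> corresponds to its complement \<open>W - {y, z}\<close> in the Koszul complex, with coefficient monomial \<open>x\<^sub>y x\<^sub>z\<close>.\<close>

definition line_cocycle :: "'p::finite set \<times> 'p set \<times> 'p \<Rightarrow> ('p, 'k::field) free" where
  "line_cocycle = (\<lambda>(W, l, y). \<Sum>z\<in>l \<inter> W - {y}. Poly_Mapping.single (face_index (W - {y, z}))
     (Poly_Mapping.single (squarefree_mono {y, z}) (insert_sign z (W - {y, z}))))"

text \<open>The value of the coboundary on the triangle with vertices \<open>pick W\<close>, the base point \<open>x\<close> of the line, and \<open>y\<close>. The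
  triangle is not a face, so this need not vanish on cocycles of \<open>\<Lambda>\<close>; up to sign, it is the value
  on the edge \<open>{x, y}\<close> of the cocycle after its normalization at \<open>pick W\<close>. The sign factors make the
  pairing with the line cocycles equal to \<open>1\<close>.\<close>

definition triangle_value :: "'p::finite set \<times> 'p set \<times> 'p \<Rightarrow> ('p, 'k::field) free \<Rightarrow> 'k" where
  "triangle_value = (\<lambda>(W, l, y) f.
     let w = pick W; x = pick (l \<inter> W); \<tau> = W - {w, x, y}
     in insert_sign w \<tau> * insert_sign x (insert w \<tau>) * multi_coeff (koszul_diff f) (squarefree_mono W) \<tau>)"

lemma tor_indexD:
  assumes "(W, l, y) \<in> tor_index L j"
  shows "card W = j" "l \<in> L" "pick W \<notin> l" "pick (l \<inter> W) \<in> l \<inter> W" "y \<in> l \<inter> W"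
    "y \<noteq> pick (l \<inter> W)"
  using assms pick_in[of "l \<inter> W"] by (auto simp: tor_index_def)

lemma multi_coeff_line_cocycle:
  assumes "y \<in> W"
  shows "multi_coeff (line_cocycle (W, l, y) :: ('p::finite, 'k::field) free) a \<sigma> =
    (if a = squarefree_mono W
     then \<Sum>z\<in>l \<inter> W - {y}. if \<sigma> = W - {y, z} then insert_sign z \<sigma> else 0 else 0)"
proof -
  have "squarefree_mono {y, z} + squarefree_mono (W - {y, z}) = squarefree_mono W" if "z \<in> W" for z
    using squarefree_mono_diff_add[of "{y, z}" W] assms that by (simp add: add.commute)
  then have "multi_coeff (Poly_Mapping.single (face_index (W - {y, z})) (Poly_Mapping.single
        (squarefree_mono {y, z}) (insert_sign z (W - {y, z})))) a \<sigma> =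
      (if a = squarefree_mono W then if \<sigma> = W - {y, z} then insert_sign z \<sigma> else 0 else (0 :: 'k))"
    if "z \<in> l \<inter> W - {y}" for z
    using that by (auto simp: multi_coeff_single)
  then show ?thesis by (simp add: line_cocycle_def multi_coeff_sum)
qed

lemma multi_coeff_line_cocycle_pair:
  assumes "y \<in> W" "z \<in> l \<inter> W" "z \<noteq> y"
  shows "multi_coeff (line_cocycle (W, l, y)) (squarefree_mono W) (W - {y, z}) =
    (insert_sign z (W - {y, z}) :: 'k::field)"
proof -
  have "(\<Sum>z'\<in>l \<inter> W - {y}. if W - {y, z} = W - {y, z'} then insert_sign z' (W - {y, z}) else 0) =
      (\<Sum>z'\<in>l \<inter> W - {y}. if z' = z then insert_sign z (W - {y, z}) else (0 :: 'k))"
    by (rule sum.cong) (use assms in auto)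
  then show ?thesis using assms by (simp add: multi_coeff_line_cocycle)
qed

lemma line_cocycle_nonzeroD:
  assumes "y \<in> W" "multi_coeff (line_cocycle (W, l, y)) a \<sigma> \<noteq> (0 :: 'k::field)"
  obtains z where "z \<in> l \<inter> W" "z \<noteq> y" "\<sigma> = W - {y, z}" "a = squarefree_mono W"
proof -
  have a: "a = squarefree_mono W"
    and "(\<Sum>z\<in>l \<inter> W - {y}. if \<sigma> = W - {y, z} then insert_sign z \<sigma> else (0 :: 'k)) \<noteq> 0"
    using assms by (auto simp: multi_coeff_line_cocycle split: if_splits)
  moreover have "(\<Sum>z\<in>l \<inter> W - {y}. if \<sigma> = W - {y, z} then insert_sign z \<sigma> else (0 :: 'k)) = 0"
    if "\<nexists>z. z \<in> l \<inter> W - {y} \<and> \<sigma> = W - {y, z}"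
    by (rule sum.neutral) (use that in auto)
  ultimately obtain z where "z \<in> l \<inter> W - {y}" "\<sigma> = W - {y, z}" by blast
  then show ?thesis using that a by blast
qed

lemma line_cocycle_free:
  assumes t: "t \<in> tor_index L (n + 2)"
  shows "(line_cocycle t :: ('p::finite, 'k::field) free) \<in> koszul_free n"
    and "(line_cocycle t :: ('p, 'k) free) \<in> homogeneous (\<lambda>_. n) (n + 2)"
proof -
  obtain W l y where t': "t = (W, l, y)" by (cases t)
  note d = tor_indexD[OF t[unfolded t']]
  have y: "y \<in> W" using d by simp
  show free: "(line_cocycle t :: ('p, 'k) free) \<in> koszul_free n"
    unfolding t' line_cocycle_def prod.case
  proof (rule rmod.subspace_sum[OF subspace_free_on])
    fix z assume "z \<in> l \<inter> W - {y}"
    then have "card (W - {y, z}) = n" using d y by (subst card_Diff_subset) auto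
    then show "Poly_Mapping.single (face_index (W - {y, z})) (Poly_Mapping.single (squarefree_mono {y, z})
        (insert_sign z (W - {y, z}))) \<in> koszul_free n"
      by (auto simp: free_on_def)
  qed
  show "(line_cocycle t :: ('p, 'k) free) \<in> homogeneous (\<lambda>_. n) (n + 2)"
    unfolding homogeneous_koszul_iff[OF free]
  proof (intro allI impI)
    fix a \<sigma> assume "multi_coeff (line_cocycle t :: ('p, 'k) free) a \<sigma> \<noteq> 0"
    then have "a = squarefree_mono W" unfolding t' by (rule line_cocycle_nonzeroD[OF y])
    then show "total_degree a = n + 2" using d(1) by simp
  qed
qed

lemma module_hom_triangle_value: "module_hom kscale (*) (triangle_value t :: ('p::finite, 'k::field) free \<Rightarrow> 'k)"
proof -
  obtain W l y where t: "t = (W, l, y)" by (cases t)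
  have "module ((*) :: 'k \<Rightarrow> 'k \<Rightarrow> 'k)" by unfold_locales (simp_all add: algebra_simps)
  then show ?thesis
    unfolding module_hom_iff t triangle_value_def Let_def prod.case
    by (intro conjI kvs.module_axioms)
      (simp_all add: module_hom.add[OF module_hom_koszul_diff] multi_coeff_add algebra_simps
        module_hom.scale[OF module_hom_kscale[OF module_hom_koszul_diff]] multi_coeff_kscale)
qed

lemma simplex_boundary_zero: "(\<And>p. p \<in> A - \<tau> \<Longrightarrow> c (insert p \<tau>) = 0) \<Longrightarrow> simplex_boundary A c \<tau> = 0"
  by (simp add: simplex_boundary_def)

lemma dual_system_Int:
  assumes "dual_system Z B b \<phi> J" "module.subspace kscale H" "\<And>t. t \<in> J \<Longrightarrow> b t \<in> H"
  shows "dual_system (Z \<inter> H) (B \<inter> H) b \<phi> J"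
  using assms unfolding dual_system_def by (auto intro: kvs.subspace_inter)

lemma finite_tor_index: "finite (tor_index L j)"
  unfolding tor_index_def by auto

context
  fixes L :: "'p::finite set set"
  assumes linear: "linear_space (UNIV :: 'p set) L" and nontrivial: "2 \<le> card (UNIV :: 'p set)"
begin

lemma two_points: "x \<noteq> y \<Longrightarrow> \<exists>!l. l \<in> L \<and> x \<in> l \<and> y \<in> l"
  using linear by (simp add: linear_space_def)

lemma line_unique: "l \<in> L \<Longrightarrow> m \<in> L \<Longrightarrow> x \<noteq> y \<Longrightarrow> {x, y} \<subseteq> l \<Longrightarrow> {x, y} \<subseteq> m \<Longrightarrow> l = m"
  using two_points[of x y] by (metis insert_subset)

lemma line_unique_card:
  assumes "l \<in> L" "m \<in> L" "2 \<le> card S" "S \<subseteq> l" "S \<subseteq> m"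
  shows "l = m"
proof -
  obtain T where "T \<subseteq> S" "card T = 2" using assms(3) obtain_subset_with_card_n by metis
  then obtain x y where "x \<noteq> y" "{x, y} \<subseteq> S" by (auto simp: card_2_iff)
  then show ?thesis using assms by (intro line_unique[of l m x y]) auto
qed

lemma pair_in_line:
  obtains l where "l \<in> L" "x \<in> l" "y \<in> l"
proof (cases "x = y")
  case True
  obtain z where "z \<noteq> x"
    using nontrivial by (metis (full_types) card_le_Suc0_iff_eq finite not_less_eq_eq numeral_2_eq_2)
  then show ?thesis using two_points[of z x] that True by metis
next
  case False
  then show ?thesis using two_points[of x y] that by metis
qed

text \<open>Any two points lie on a line, so the complex contains all edges. Hence its cohomology starts in
  degree one.\<close>

lemma small_set_face:
  assumes "card S \<le> 2"
  shows "S \<in> incidence_complex L"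
proof -
  consider "card S = 0" | "card S = 1" | "card S = 2" using assms by linarith
  then obtain x y where "S \<subseteq> {x, y}"
    by cases (auto simp: card_2_iff card_1_singleton_iff)
  moreover obtain l where "l \<in> L" "x \<in> l" "y \<in> l" by (rule pair_in_line)
  ultimately show ?thesis by (intro incidence_complexI[of l]) auto
qed

abbreviation (input) SR :: "('p, 'k::field) polyring set" where
  "SR \<equiv> stanley_reisner_ideal (incidence_complex L)"

lemmas cycles_iff = koszul_tor_cycles_iff[OF incidence_complex_down]
lemmas boundaries_iff = koszul_tor_boundaries_iff[OF incidence_complex_down]

text \<open>On the line \<open>l\<close> itself the element is a coboundary, so its coboundary vanishes there; on the triangles in
  a different line \<open>m\<close> it is zero, because \<open>l\<close> and \<open>m\<close> share at most one point and so no edge.\<close>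

lemma line_cocycle_cycle:
  assumes t: "t \<in> tor_index L (Suc i + 2)"
  shows "(line_cocycle t :: ('p, 'k::field) free) \<in> tor_cycles koszul SR (Suc i)"
  unfolding cycles_iff
proof (intro conjI line_cocycle_free(1)[OF t] allI impI)
  obtain W l y where t': "t = (W, l, y)" by (cases t)
  note d = tor_indexD[OF t[unfolded t']]
  have y: "y \<in> W" "y \<in> l" using d by simp_all
  let ?b = "multi_coeff (line_cocycle t :: ('p, 'k) free)"
  fix a :: "'p \<Rightarrow>\<^sub>0 nat" and \<tau>
  assume \<tau>: "\<tau> \<subseteq> Poly_Mapping.keys a" and face: "Poly_Mapping.keys (a - squarefree_mono \<tau>) \<in> incidence_complex L"
  have "simplex_boundary (Poly_Mapping.keys a) (?b a) \<tau> = 0"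
  proof (cases "a = squarefree_mono W")
    case False
    then show ?thesis
      by (intro simplex_boundary_zero) (auto simp: t' multi_coeff_line_cocycle y)
  next
    case True
    obtain m where m: "m \<in> L" "W - \<tau> \<subseteq> m"
      using face by (auto simp: True keys_squarefree_mono_diff incidence_complex_def)
    show ?thesis
    proof (cases "m = l")
      case False
      show ?thesis
      proof (rule simplex_boundary_zero, rule ccontr)
        fix p assume p: "p \<in> Poly_Mapping.keys a - \<tau>" and "?b a (insert p \<tau>) \<noteq> 0"
        then obtain z where z: "z \<in> l \<inter> W" "z \<noteq> y" "insert p \<tau> = W - {y, z}"
          unfolding t' using line_cocycle_nonzeroD[OF y(1)] by metis
        then have "{y, z} \<subseteq> W - \<tau>" using y by auto
        then show False using line_unique[OF d(2) m(1) z(2)[symmetric]] m(2) y z False by auto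
      qed
    next
      case ml: True
      \<comment> \<open>The indicator function of the vertex \<open>y\<close>, in complementary notation.\<close>
      define c :: "'p set \<Rightarrow> 'k" where "c \<rho> = (if \<rho> = W - {y} then 1 else 0)" for \<rho>
      have bc: "?b a \<sigma> = simplex_boundary W c \<sigma>" if \<sigma>: "W - \<sigma> \<subseteq> l" "\<sigma> \<subseteq> W" for \<sigma>
      proof -
        have "?b a \<sigma> = (\<Sum>z\<in>l \<inter> W - {y}. if \<sigma> = W - {y, z} then insert_sign z \<sigma> else 0)"
          by (simp add: t' True multi_coeff_line_cocycle y)
        also have "\<dots> = (\<Sum>z\<in>W - \<sigma>. insert_sign z \<sigma> * c (insert z \<sigma>))"
        proof (rule sum.mono_neutral_cong)
          show "(if \<sigma> = W - {y, z} then insert_sign z \<sigma> else 0) = (0 :: 'k)"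
            if "z \<in> l \<inter> W - {y} - (W - \<sigma>)" for z
            using that by auto
          show "insert_sign z \<sigma> * c (insert z \<sigma>) = 0" if "z \<in> W - \<sigma> - (l \<inter> W - {y})" for z
            using that \<sigma> by (auto simp: c_def)
          show "(if \<sigma> = W - {y, z} then insert_sign z \<sigma> else 0) = insert_sign z \<sigma> * c (insert z \<sigma>)"
            if "z \<in> (l \<inter> W - {y}) \<inter> (W - \<sigma>)" for z
          proof -
            have "\<sigma> = W - {y, z} \<longleftrightarrow> insert z \<sigma> = W - {y}" using that \<sigma> by auto
            then show ?thesis by (simp add: c_def)
          qed
        qed auto
        finally show ?thesis by (simp add: simplex_boundary_def)
      qed
      have "simplex_boundary W (?b a) \<tau> = simplex_boundary W (simplex_boundary W c) \<tau>"
        unfolding simplex_boundary_def[of W "?b a"] simplex_boundary_def[of W "simplex_boundary W c"]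
      proof (intro sum.cong refl arg_cong2[where f = "(*)"] bc)
        fix p assume "p \<in> W - \<tau>"
        then show "W - insert p \<tau> \<subseteq> l" "insert p \<tau> \<subseteq> W" using m(2) \<tau> by (auto simp: ml True)
      qed
      then show ?thesis by (simp add: True simplex_boundary_boundary)
    qed
  qed
  then show "multi_coeff (koszul_diff (line_cocycle t :: ('p, 'k) free)) a \<tau> = 0"
    by (simp add: multi_coeff_koszul_diff)
qed

text \<open>Of the three edges of the triangle \<open>{w, x, y'}\<close>, those containing \<open>w = pick W\<close> are not on \<open>l\<close>. The
  third edge \<open>{x, y'}\<close> carries a nonzero value only if it is \<open>{y, z}\<close> for some \<open>z\<close> in \<open>l\<close>; then the two
  lines agree, hence also the base points, and \<open>y\<close> is the other endpoint.\<close>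

lemma triangle_value_line_cocycle:
  assumes s: "s \<in> tor_index L j" and t: "t \<in> tor_index L j"
  shows "triangle_value t (line_cocycle s) = (if s = t then 1 else 0 :: 'k::field)"
proof -
  obtain W l y where s': "s = (W, l, y)" by (cases s)
  obtain W' l' y' where t': "t = (W', l', y')" by (cases t)
  note ds = tor_indexD[OF s[unfolded s']] and dt = tor_indexD[OF t[unfolded t']]
  let ?b = "multi_coeff (line_cocycle s :: ('p, 'k) free) (squarefree_mono W')"
  define w where "w = pick W'"
  define x where "x = pick (l' \<inter> W')"
  define \<tau> where "\<tau> = W' - {w, x, y'}"
  have x: "x \<in> l'" "x \<in> W'" "y' \<in> l'" "y' \<in> W'" "x \<noteq> y'" "w \<notin> l'" using dt by (auto simp: x_def w_def)
  have w: "w \<in> W'" using x(2) pick_in[of W'] by (auto simp: w_def)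
  have wne: "w \<noteq> x" "w \<noteq> y'" using x by auto
  have W\<tau>: "W' - \<tau> = {w, x, y'}" using x w by (auto simp: \<tau>_def)
  have tv: "triangle_value t (line_cocycle s) = insert_sign w \<tau> * insert_sign x (insert w \<tau>)
      * (\<Sum>p\<in>{w, x, y'}. insert_sign p \<tau> * ?b (insert p \<tau>))"
    by (simp add: t' triangle_value_def w_def[symmetric] x_def[symmetric] \<tau>_def[symmetric]
        multi_coeff_koszul_diff simplex_boundary_def W\<tau>)
  have nz: "W' = W \<and> (\<exists>z\<in>l. z \<noteq> y \<and> W - \<sigma> = {y, z})" if nz: "?b \<sigma> \<noteq> 0" for \<sigma>
  proof -
    from ds(5) have "y \<in> W" by simp
    from line_cocycle_nonzeroD[OF this nz[unfolded s']] obtain z where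
      z: "z \<in> l \<inter> W" "z \<noteq> y" "\<sigma> = W - {y, z}" "squarefree_mono W' = squarefree_mono W" by blast
    then have "W - \<sigma> = {y, z}" using ds(5) by auto
    with z show ?thesis by auto
  qed
  have x0: "?b (insert x \<tau>) = 0"
  proof (rule ccontr)
    assume "?b (insert x \<tau>) \<noteq> 0"
    from nz[OF this] obtain z where z: "W' = W" "z \<in> l" "W - insert x \<tau> = {y, z}" by blast
    then have "w \<in> {y, z}" using w wne by (auto simp: \<tau>_def)
    then show False using z ds by (auto simp: w_def)
  qed
  have y0: "?b (insert y' \<tau>) = 0"
  proof (rule ccontr)
    assume "?b (insert y' \<tau>) \<noteq> 0"
    from nz[OF this] obtain z where z: "W' = W" "z \<in> l" "W - insert y' \<tau> = {y, z}" by blast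
    then have "w \<in> {y, z}" using w wne by (auto simp: \<tau>_def)
    then show False using z ds by (auto simp: w_def)
  qed
  have ins: "insert w \<tau> = W' - {y', x}" using wne w by (auto simp: \<tau>_def)
  have w0: "?b (insert w \<tau>) = (if s = t then insert_sign x (insert w \<tau>) else 0)"
  proof (cases "s = t")
    case True
    then have eq: "W = W'" "l = l'" "y = y'" by (auto simp: s' t')
    have "multi_coeff (line_cocycle (W', l', y') :: ('p, 'k) free) (squarefree_mono W') (W' - {y', x}) =
        insert_sign x (W' - {y', x})"
      by (rule multi_coeff_line_cocycle_pair) (use x in auto)
    then show ?thesis using True unfolding ins by (simp add: s' eq)
  next
    case False
    have "?b (insert w \<tau>) = 0"
    proof (rule ccontr)
      assume "?b (insert w \<tau>) \<noteq> 0"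
      from nz[OF this] obtain z where z: "W' = W" "z \<in> l" "z \<noteq> y" "W - insert w \<tau> = {y, z}" by blast
      have "W - insert w \<tau> = {y', x}" using z(1) x ins by auto
      with z have pair: "{y, z} = {y', x}" by simp
      have "{y, z} \<subseteq> l" using z(2) ds(5) by simp
      moreover have "{y, z} \<subseteq> l'" unfolding pair using x by simp
      ultimately have "l = l'" by (rule line_unique[OF ds(2) dt(2) z(3)[symmetric]])
      then have "x = pick (l \<inter> W)" using z(1) by (simp add: x_def)
      then have "y \<noteq> x" using ds(6) by simp
      then have "y = y'" using pair by (metis doubleton_eq_iff)
      with \<open>l = l'\<close> z(1) False show False by (simp add: s' t')
    qed
    then show ?thesis using False by simp
  qed
  have "(\<Sum>p\<in>{w, x, y'}. insert_sign p \<tau> * ?b (insert p \<tau>)) =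
      insert_sign w \<tau> * (if s = t then insert_sign x (insert w \<tau>) else 0)"
    using wne x by (simp add: x0 y0 w0)
  then have "triangle_value t (line_cocycle s :: ('p, 'k) free) =
      (if s = t then (insert_sign w \<tau> * insert_sign w \<tau>)
        * (insert_sign x (insert w \<tau>) * insert_sign x (insert w \<tau>)) else 0)"
    unfolding tv by (simp only: mult_ac split: if_split) simp
  then show ?thesis unfolding insert_sign_square by simp
qed

text \<open>The triangle value depends only on the coefficients at the edges of the triangle. Edges are faces, so
  there a boundary modulo the ideal agrees with a boundary of the Koszul complex, whose
  differential is zero.\<close>

lemma triangle_value_boundary:
  assumes t: "t \<in> tor_index L (Suc i + 2)" and z: "z \<in> tor_boundaries koszul SR (Suc i)"
  shows "triangle_value t z = (0 :: 'k::field)"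
proof -
  obtain W l y where t': "t = (W, l, y)" by (cases t)
  note d = tor_indexD[OF t[unfolded t']]
  define w where "w = pick W"
  define x where "x = pick (l \<inter> W)"
  define \<tau> where "\<tau> = W - {w, x, y}"
  obtain g where g: "\<And>a \<sigma>. \<sigma> \<subseteq> Poly_Mapping.keys a \<Longrightarrow>
      Poly_Mapping.keys (a - squarefree_mono \<sigma>) \<in> incidence_complex L \<Longrightarrow>
      multi_coeff z a \<sigma> = multi_coeff (koszul_diff g) a \<sigma>"
    using z unfolding boundaries_iff by blast
  have W: "\<tau> \<subseteq> W" by (auto simp: \<tau>_def)
  have "multi_coeff (koszul_diff z) (squarefree_mono W) \<tau> =
      simplex_boundary W (multi_coeff z (squarefree_mono W)) \<tau>"
    using W by (simp add: multi_coeff_koszul_diff)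
  also have "\<dots> = simplex_boundary W (multi_coeff (koszul_diff g) (squarefree_mono W)) \<tau>"
    unfolding simplex_boundary_def
  proof (intro sum.cong refl arg_cong2[where f = "(*)"] g)
    fix p assume p: "p \<in> W - \<tau>"
    then show "insert p \<tau> \<subseteq> Poly_Mapping.keys (squarefree_mono W)" using W by auto
    have "W - insert p \<tau> \<subseteq> {w, x, y} - {p}" by (auto simp: \<tau>_def)
    moreover have "card ({w, x, y} - {p}) \<le> 2"
    proof -
      have "p \<in> {w, x, y}" using p by (auto simp: \<tau>_def)
      then have "card ({w, x, y} - {p}) = card {w, x, y} - 1" by (rule card_Diff_singleton)
      also have "card {w, x, y} \<le> 3" by (simp add: card_insert_if)
      finally show ?thesis by simp
    qed
    ultimately have "card (W - insert p \<tau>) \<le> 2" by (meson card_mono finite le_trans)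
    then show "Poly_Mapping.keys (squarefree_mono W - squarefree_mono (insert p \<tau>)) \<in> incidence_complex L"
      unfolding keys_squarefree_mono_diff by (rule small_set_face)
  qed
  also have "\<dots> = multi_coeff (koszul_diff (koszul_diff g)) (squarefree_mono W) \<tau>"
    using W by (simp add: multi_coeff_koszul_diff[of "koszul_diff g"])
  also have "\<dots> = 0" by (simp add: koszul_diff_koszul_diff) (simp add: multi_coeff_def)
  finally show ?thesis
    by (simp add: t' triangle_value_def w_def[symmetric] x_def[symmetric] \<tau>_def[symmetric])
qed

text \<open>If the line through \<open>u\<close> and \<open>v\<close> contains \<open>w = pick W\<close>, the triangle is a face. If \<open>u\<close> or \<open>v\<close> is the base point
  of the line, the claim is among the hypotheses. Otherwise, let \<open>x\<close> be the base point and consider the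
  tetrahedron \<open>{w, x, u, v}\<close>: the twofold coboundary vanishes on it, and so do the values on the three
  other triangles.\<close>

lemma triangle_values_zero:
  fixes z :: "('p, 'k::field) free"
  assumes z: "z \<in> tor_cycles koszul SR (Suc i)"
    and vals: "\<And>t. t \<in> tor_index L (Suc i + 2) \<Longrightarrow> triangle_value t z = 0"
    and W: "card W = Suc i + 2" and uv: "u \<in> W - {pick W}" "v \<in> W - {pick W}" "u \<noteq> v"
  shows "multi_coeff (koszul_diff z) (squarefree_mono W) (W - {pick W, u, v}) = 0"
proof -
  let ?h = "multi_coeff (koszul_diff z) (squarefree_mono W)"
  define w where "w = pick W"
  have w: "w \<in> W" "w \<noteq> u" "w \<noteq> v" using uv pick_in[of W] by (auto simp: w_def)
  have face: "?h \<sigma> = 0" if "\<sigma> \<subseteq> W" "W - \<sigma> \<in> incidence_complex L" for \<sigma>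
    using z that unfolding cycles_iff by (simp add: keys_squarefree_mono_diff)
  obtain l where l: "l \<in> L" "u \<in> l" "v \<in> l" by (rule pair_in_line)
  define x where "x = pick (l \<inter> W)"
  have x: "x \<in> l" "x \<in> W" using pick_in[of "l \<inter> W"] l uv by (auto simp: x_def)
  show ?thesis
  proof (cases "w \<in> l")
    case True
    have "W - (W - {w, u, v}) = {w, u, v}" using w uv by auto
    then show ?thesis
      unfolding w_def[symmetric]
      by (intro face) (auto intro!: incidence_complexI[OF l(1)] simp: True l)
  next
    case False
    have base: "?h (W - {w, x, q}) = 0" if "q \<in> l" "q \<in> W" "q \<noteq> x" for q
    proof -
      have "(W, l, q) \<in> tor_index L (Suc i + 2)"
        using W l False that by (auto simp: tor_index_def w_def x_def)
      from vals[OF this] show ?thesis by (simp add: triangle_value_def w_def x_def Let_def)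
    qed
    consider "u = x" | "v = x" | "u \<noteq> x" "v \<noteq> x" by blast
    then show ?thesis
    proof cases
      case 1
      then show ?thesis using base[of v] l uv by (simp add: w_def)
    next
      case 2
      then show ?thesis using base[of u] l uv by (simp add: w_def insert_commute)
    next
      case 3
      define \<rho> where "\<rho> = W - {w, x, u, v}"
      have wx: "w \<noteq> x" using False x by auto
      have W\<rho>: "W - \<rho> = {w, x, u, v}" using x uv w by (auto simp: \<rho>_def)
      have i1: "insert w \<rho> = W - {x, u, v}" "insert u \<rho> = W - {w, x, v}" "insert v \<rho> = W - {w, x, u}"
          "insert x \<rho> = W - {w, u, v}"
        using 3 wx uv w x by (auto simp: \<rho>_def)
      have "W - (W - {x, u, v}) = {x, u, v}" using x uv by auto
      then have h1: "?h (insert w \<rho>) = 0"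
        unfolding i1 by (intro face) (auto intro!: incidence_complexI[OF l(1)] simp: l x)
      have h2: "?h (insert u \<rho>) = 0" "?h (insert v \<rho>) = 0"
        unfolding i1 using base l uv 3 by auto
      have "0 = multi_coeff (koszul_diff (koszul_diff z)) (squarefree_mono W) \<rho>"
        by (simp add: koszul_diff_koszul_diff) (simp add: multi_coeff_def)
      also have "\<dots> = simplex_boundary W ?h \<rho>"
        unfolding multi_coeff_koszul_diff[of "koszul_diff z"] keys_squarefree_mono by (simp add: \<rho>_def)
      also have "\<dots> = insert_sign x \<rho> * ?h (insert x \<rho>)"
        unfolding simplex_boundary_def W\<rho> using 3 wx uv w by (simp add: h1 h2)
      finally have "?h (insert x \<rho>) = 0" by simp
      then show ?thesis by (simp add: i1 w_def)
    qed
  qed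
qed

text \<open>The vertices for contracting the complex. If the multidegree is not squarefree, a repeated variable
  works, since its presence in \<open>\<sigma>\<close> does not affect the support of \<open>a - \<sigma>\<close>. If the complement of \<open>\<sigma>\<close> has at least
  two points and lies in a line, the line is unique and one contracts it to a base point; for
  smaller complements, which do not determine a line, the fixed vertex \<open>pick A\<close> is used throughout.\<close>

definition cone_vertex :: "('p \<Rightarrow>\<^sub>0 nat) \<Rightarrow> 'p set \<Rightarrow> 'p" where
  "cone_vertex a \<sigma> =
    (let A = Poly_Mapping.keys a in
     if \<exists>p. 2 \<le> Poly_Mapping.lookup a p then SOME p. 2 \<le> Poly_Mapping.lookup a p
     else if 2 \<le> card (A - \<sigma>) \<and> (\<exists>l\<in>L. A - \<sigma> \<subseteq> l) then pick (A \<inter> (THE l. l \<in> L \<and> A - \<sigma> \<subseteq> l))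
     else pick A)"

text \<open>The cone over \<open>z\<close> with the chosen vertices is a chain whose boundary agrees with \<open>z\<close> modulo the ideal. The
  point is to see that the local cycle condition holds at \<open>\<sigma> - {p}\<close>. This follows from \<open>z\<close> being a cycle
  whenever the complement of \<open>\<sigma> - {p}\<close> still gives a face; that fails at most for a triangle
  containing the base vertex, and there the hypothesis on the triangle values is used. Hence all
  homology in degrees other than \<open>Suc i + 2\<close> vanishes as well.\<close>

lemma triangle_values_detect_boundaries:
  fixes z :: "('p, 'k::field) free"
  assumes z: "z \<in> tor_cycles koszul SR (Suc i)"
    and vals: "\<And>t. t \<in> tor_index L (Suc i + 2) \<Longrightarrow> triangle_value t z = 0"
  shows "z \<in> tor_boundaries koszul SR (Suc i)"
  unfolding boundaries_iff
proof (intro conjI bexI[of _ "cone cone_vertex z"] allI impI)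
  have free: "z \<in> koszul_free (Suc i)"
    and cyc: "\<And>a \<tau>. \<tau> \<subseteq> Poly_Mapping.keys a \<Longrightarrow>
      Poly_Mapping.keys (a - squarefree_mono \<tau>) \<in> incidence_complex L \<Longrightarrow>
      multi_coeff (koszul_diff z) a \<tau> = 0"
    using z unfolding cycles_iff by blast+
  show "z \<in> koszul_free (Suc i)" by (rule free)
  show cone: "cone cone_vertex z \<in> koszul_free (Suc (Suc i))" using cone_free[OF free] .
  fix a :: "'p \<Rightarrow>\<^sub>0 nat" and \<sigma>
  assume \<sigma>: "\<sigma> \<subseteq> Poly_Mapping.keys a" and face: "Poly_Mapping.keys (a - squarefree_mono \<sigma>) \<in> incidence_complex L"
  let ?A = "Poly_Mapping.keys a"
  show "multi_coeff z a \<sigma> = multi_coeff (koszul_diff (cone cone_vertex z)) a \<sigma>"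
  proof (cases "card \<sigma> = Suc i")
    case False
    then show ?thesis
      using multi_coeff_koszul_free[OF free] multi_coeff_koszul_free[OF koszul_diff_free[OF cone]] by simp
  next
    case card: True
    then have "\<sigma> \<noteq> {}" by auto
    then have A: "?A \<noteq> {}" using \<sigma> by auto
    show ?thesis
    proof (cases "\<exists>p. 2 \<le> Poly_Mapping.lookup a p")
      case True
      define p where "p = (SOME p. 2 \<le> Poly_Mapping.lookup a p)"
      have p: "2 \<le> Poly_Mapping.lookup a p" unfolding p_def using someI_ex[OF True] .
      show ?thesis
      proof (rule koszul_diff_cone[OF \<sigma>, symmetric])
        show "p \<in> ?A" using p by (simp add: in_keys_iff)
        show "cone_vertex a (insert q \<sigma>) = p" for q
          using True by (simp add: cone_vertex_def p_def)
        have "Poly_Mapping.keys (a - squarefree_mono (\<sigma> - {p})) = Poly_Mapping.keys (a - squarefree_mono \<sigma>)"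
          using p by (auto simp: in_keys_iff lookup_monomial_diff lookup_squarefree_mono split: if_splits)
        then show "multi_coeff (koszul_diff z) a (\<sigma> - {p}) = 0"
          using \<sigma> face by (intro cyc) auto
      qed
    next
      case False
      have "Poly_Mapping.lookup a q = (if q \<in> ?A then 1 else 0)" for q
        using False[unfolded not_ex, rule_format, of q] by (auto simp: in_keys_iff)
      then have a: "a = squarefree_mono ?A"
        by (intro poly_mapping_eqI) (simp add: lookup_squarefree_mono)
      have rest: "Poly_Mapping.keys (a - squarefree_mono \<rho>) = ?A - \<rho>" for \<rho>
        by (subst a) (rule keys_squarefree_mono_diff)
      obtain l where l: "l \<in> L" "?A - \<sigma> \<subseteq> l"
        using face unfolding rest by (auto simp: incidence_complex_def)
      show ?thesis
      proof (cases "card (?A - \<sigma>) \<le> 2")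
        \<comment> \<open>At most two points remain. If they form an edge, the triangle values give the cycle condition.\<close>
        case small: True
        define w where "w = pick ?A"
        have w: "w \<in> ?A" unfolding w_def using A by (rule pick_in)
        show ?thesis
        proof (rule koszul_diff_cone[OF \<sigma> w, symmetric])
          fix q assume q: "q \<in> ?A - \<sigma>"
          have "?A - insert q \<sigma> = ?A - \<sigma> - {q}" by auto
          then have "card (?A - insert q \<sigma>) \<le> 1" using small q by simp
          then show "cone_vertex a (insert q \<sigma>) = w"
            using False by (simp add: cone_vertex_def w_def)
        next
          assume w\<sigma>: "w \<in> \<sigma>"
          have "?A - (\<sigma> - {w}) = insert w (?A - \<sigma>)" using w by auto
          show "multi_coeff (koszul_diff z) a (\<sigma> - {w}) = 0"
          proof (cases "card (?A - \<sigma>) = 2")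
            case True
            then obtain u v where uv: "?A - \<sigma> = {u, v}" "u \<noteq> v" by (auto simp: card_2_iff)
            have "card ?A = Suc i + 2"
              using card_Diff_subset[of \<sigma> ?A] True card \<sigma> card_mono[of ?A \<sigma>] by simp
            moreover have "\<sigma> - {w} = ?A - {w, u, v}" using uv \<sigma> by auto
            moreover have "u \<in> ?A - {w}" "v \<in> ?A - {w}" using uv w\<sigma> by auto
            ultimately show ?thesis
              using triangle_values_zero[OF z vals, of ?A u v] uv(2) a by (simp add: w_def)
          next
            case False
            then have "card (insert w (?A - \<sigma>)) \<le> 2" using small by (simp add: card_insert_if)
            then show ?thesis
              using \<sigma> small_set_face \<open>?A - (\<sigma> - {w}) = _\<close> by (intro cyc) (auto simp: rest)
          qed
        qed
      next
        \<comment> \<open>Three or more points on \<open>l\<close>: removing one leaves at least two, which still determine \<open>l\<close>.\<close>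
        case large: False
        define p where "p = pick (?A \<inter> l)"
        have "?A - \<sigma> \<noteq> {}" using large by (metis card.empty zero_le)
        then have "p \<in> ?A \<inter> l" unfolding p_def using l(2) by (intro pick_in) auto
        then have p: "p \<in> ?A" "p \<in> l" by auto
        show ?thesis
        proof (rule koszul_diff_cone[OF \<sigma> p(1), symmetric])
          fix q assume q: "q \<in> ?A - \<sigma>"
          have "?A - insert q \<sigma> = ?A - \<sigma> - {q}" by auto
          then have c: "2 \<le> card (?A - insert q \<sigma>)" using large q by simp
          have sub: "?A - insert q \<sigma> \<subseteq> l" using l(2) by auto
          have the_l: "(THE m. m \<in> L \<and> ?A - insert q \<sigma> \<subseteq> m) = l"
            by (rule the_equality) (use l(1) sub line_unique_card[OF _ _ c] in blast)+
          have "\<exists>m\<in>L. ?A - insert q \<sigma> \<subseteq> m" using sub l(1) by blast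
          then show "cone_vertex a (insert q \<sigma>) = p"
            using False c unfolding cone_vertex_def Let_def the_l p_def by simp
        next
          have "?A - (\<sigma> - {p}) \<subseteq> l" using l(2) p by auto
          then show "multi_coeff (koszul_diff z) a (\<sigma> - {p}) = 0"
            using \<sigma> by (intro cyc) (auto simp: rest intro!: incidence_complexI[OF l(1)])
        qed
      qed
    qed
  qed
qed

lemma koszul_dual_system:
  defines "I \<equiv> stanley_reisner_ideal (incidence_complex L) :: ('p, 'k::field) polyring set"
  shows "dual_system (tor_cycles koszul I (Suc i)) (tor_boundaries koszul I (Suc i))
    line_cocycle triangle_value (tor_index L (Suc i + 2))"
  unfolding dual_system_def I_def
proof (intro conjI ballI impI)
  let ?I = "stanley_reisner_ideal (incidence_complex L) :: ('p, 'k) polyring set"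
  show "module.subspace kscale (tor_cycles koszul ?I (Suc i))"
    by (intro subspace_kscale subspace_tor_cycles subspace_stanley_reisner_ideal koszul_resolution)
  show "module.subspace kscale (tor_boundaries koszul ?I (Suc i))"
    by (intro subspace_kscale subspace_tor_boundaries subspace_stanley_reisner_ideal koszul_resolution)
qed (use line_cocycle_cycle triangle_value_line_cocycle
    triangle_value_boundary triangle_values_detect_boundaries
    finite_tor_index module_hom_triangle_value in blast)+

text \<open>The elements of the basis are homogeneous of degree \<open>n + 2\<close>, so one dual system serves for the full
  Tor module and for its component of that degree; this is linearity of the resolution.\<close>

lemma betti_incidence_complex:
  defines "I \<equiv> stanley_reisner_ideal (incidence_complex L) :: ('p, 'k::field) polyring set"
  assumes "n \<ge> 1"
  shows "betti I n = card (tor_index L (n + 2))" "graded_betti I n (n + 2) = card (tor_index L (n + 2))"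
proof -
  obtain i where n: "n = Suc i" using assms(2) by (cases n) auto
  have F: "graded_free_resolution (chosen_resolution :: ('p, 'k) aug_complex)"
    unfolding chosen_resolution_def using someI[of graded_free_resolution, OF koszul_resolution] .
  note D = koszul_dual_system[where 'k = 'k, of i, folded I_def]
  have Dj: "dual_system (tor_cycles koszul I (Suc i) \<inter> homogeneous (gdeg (koszul :: ('p, 'k) aug_complex) (Suc i)) (Suc i + 2))
      (tor_boundaries koszul I (Suc i) \<inter> homogeneous (gdeg (koszul :: ('p, 'k) aug_complex) (Suc i)) (Suc i + 2))
      line_cocycle triangle_value (tor_index L (Suc i + 2))"
    using D subspace_homogeneous line_cocycle_free(2) unfolding koszul_sel by (rule dual_system_Int)
  have I: "module.subspace (*) I" unfolding I_def by (rule subspace_stanley_reisner_ideal)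
  from tor_dual_system_transfer[OF I F koszul_resolution, of i "Suc i + 2"] D Dj
  obtain b \<phi> b' \<phi>' where
    "dual_system (tor_cycles chosen_resolution I (Suc i)) (tor_boundaries chosen_resolution I (Suc i))
      b \<phi> (tor_index L (Suc i + 2))"
    "dual_system
      (tor_cycles chosen_resolution I (Suc i) \<inter> homogeneous (gdeg (chosen_resolution :: ('p, 'k) aug_complex) (Suc i)) (Suc i + 2))
      (tor_boundaries chosen_resolution I (Suc i) \<inter> homogeneous (gdeg (chosen_resolution :: ('p, 'k) aug_complex) (Suc i)) (Suc i + 2))
      b' \<phi>' (tor_index L (Suc i + 2))"
    by metis
  from this[THEN quotient_dim_dual_system]
  show "betti I n = card (tor_index L (n + 2))" "graded_betti I n (n + 2) = card (tor_index L (n + 2))"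
    by (simp_all add: betti_def graded_betti_def n)
qed

section \<open>Counting the basis\<close>

text \<open>The lines through \<open>w\<close> partition the remaining points.\<close>

lemma sum_lines_through_vertex:
  assumes w: "w \<in> W"
  shows "(\<Sum>l | l \<in> L \<and> w \<in> l. card (l \<inter> W) - 1) = card W - 1"
proof -
  have "card (\<Union>l\<in>{l \<in> L. w \<in> l}. l \<inter> W - {w}) = (\<Sum>l | l \<in> L \<and> w \<in> l. card (l \<inter> W - {w}))"
  proof (rule card_UN_disjoint)
    show "\<forall>l\<in>{l \<in> L. w \<in> l}. \<forall>m\<in>{l \<in> L. w \<in> l}. l \<noteq> m \<longrightarrow> (l \<inter> W - {w}) \<inter> (m \<inter> W - {w}) = {}"
      using line_unique by blast
  qed auto
  moreover have "(\<Union>l\<in>{l \<in> L. w \<in> l}. l \<inter> W - {w}) = W - {w}"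
  proof
    have "\<exists>l. l \<in> L \<and> w \<in> l \<and> x \<in> l" if "x \<noteq> w" for x
      using two_points[of w x] that by metis
    then show "W - {w} \<subseteq> (\<Union>l\<in>{l \<in> L. w \<in> l}. l \<inter> W - {w})" by fastforce
  qed auto
  moreover have "card (l \<inter> W - {w}) = card (l \<inter> W) - 1" if "w \<in> l" for l
    using w that by simp
  ultimately show ?thesis using w by simp
qed

lemma card_tor_index_eq:
  "card (tor_index L j) = (\<Sum>W | card W = j. \<Sum>l | l \<in> L \<and> pick W \<notin> l. card (l \<inter> W) - 1)"
proof -
  have "card (l \<inter> W - {pick (l \<inter> W)}) = card (l \<inter> W) - 1" for l W :: "'p set"
    using pick_in[of "l \<inter> W"] by (cases "l \<inter> W = {}") auto
  then show ?thesis unfolding tor_index_def by simp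
qed

text \<open>For fixed \<open>W\<close> the sum of \<open>card (l \<inter> W) - 1\<close> over the lines meeting \<open>W\<close>, minus the contribution \<open>j - 1\<close> of
  the lines through \<open>pick W\<close>, is found by counting incidences \<open>x \<in> l \<inter> W\<close>. Summing over \<open>W\<close>, a line of size \<open>k\<close> misses
  as many sets \<open>W\<close> as there are \<open>j\<close>-subsets of its complement.\<close>

lemma card_tor_index:
  assumes j: "j \<ge> 1" and through: "\<And>x. card {l \<in> L. x \<in> l} = r" and size: "\<And>l. l \<in> L \<Longrightarrow> card l = k"
  shows "int (card (tor_index L j)) =
    (int j * int r - int (card L) - int j + 1) * int (card (UNIV :: 'p set) choose j)
      + int (card L) * int ((card (UNIV :: 'p set) - k) choose j)"
proof -
  have single: "int (\<Sum>l | l \<in> L \<and> pick W \<notin> l. card (l \<inter> W) - 1) =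
      int j * int r - int (card L) - int j + 1 + int (card {l \<in> L. l \<inter> W = {}})" if W: "card W = j" for W
  proof -
    have "W \<noteq> {}" using W j by auto
    then have w: "pick W \<in> W" by (rule pick_in)
    have "(\<Sum>l\<in>L. card (l \<inter> W) - 1) =
        (\<Sum>l | l \<in> L \<and> pick W \<in> l. card (l \<inter> W) - 1) + (\<Sum>l | l \<in> L \<and> pick W \<notin> l. card (l \<inter> W) - 1)"
      by (subst sum.union_disjoint[symmetric]) (auto intro!: sum.cong)
    then have 1: "(\<Sum>l\<in>L. card (l \<inter> W) - 1) = (j - 1) + (\<Sum>l | l \<in> L \<and> pick W \<notin> l. card (l \<inter> W) - 1)"
      using sum_lines_through_vertex[OF w] W by simp
    have "(\<Sum>l\<in>L. card (l \<inter> W)) = (\<Sum>l\<in>L. \<Sum>x\<in>W. if x \<in> l then 1 else 0)"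
      by (intro sum.cong) (simp_all add: Int_commute flip: sum.inter_restrict)
    also have "\<dots> = (\<Sum>x\<in>W. \<Sum>l\<in>L. if x \<in> l then 1 else 0)" by (rule sum.swap)
    also have "\<dots> = (\<Sum>x\<in>W. r)"
      by (intro sum.cong refl) (simp add: through flip: sum.inter_filter)
    finally have 2: "(\<Sum>l\<in>L. card (l \<inter> W)) = j * r" using W by simp
    have "int (card (l \<inter> W)) = int (card (l \<inter> W) - 1) + 1 - (if l \<inter> W = {} then 1 else 0)" for l
      by (cases "card (l \<inter> W)") auto
    then have "int (\<Sum>l\<in>L. card (l \<inter> W)) =
        (\<Sum>l\<in>L. int (card (l \<inter> W) - 1) + 1 - (if l \<inter> W = {} then 1 else 0))"
      unfolding of_nat_sum by (intro sum.cong refl)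
    also have "\<dots> = int (\<Sum>l\<in>L. card (l \<inter> W) - 1) + int (card L) - int (card {l \<in> L. l \<inter> W = {}})"
      by (simp add: sum_subtractf sum.distrib flip: sum.inter_filter)
    finally show ?thesis unfolding 1 2 using j by simp
  qed
  have "(\<Sum>W | card (W :: 'p set) = j. card {l \<in> L. l \<inter> W = {}}) = (\<Sum>W | card W = j. \<Sum>l\<in>L. if l \<inter> W = {} then 1 else 0)"
    by (intro sum.cong refl) (simp flip: sum.inter_filter)
  also have "\<dots> = (\<Sum>l\<in>L. \<Sum>W | card W = j. if l \<inter> W = {} then 1 else 0)" by (rule sum.swap)
  also have "\<dots> = (\<Sum>l\<in>L. (card (UNIV :: 'p set) - k) choose j)"
  proof (intro sum.cong refl)
    fix l assume "l \<in> L"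
    have "{W. card W = j \<and> l \<inter> W = {}} = {W. W \<subseteq> - l \<and> card W = j}" by auto
    then show "(\<Sum>W | card W = j. if l \<inter> W = {} then 1 else 0) = (card (UNIV :: 'p set) - k) choose j"
      using n_subsets[of "- l" j] size[OF \<open>l \<in> L\<close>]
        card_Diff_subset[of l UNIV] by (simp add: Compl_eq_Diff_UNIV flip: sum.inter_filter)
  qed
  finally have missed: "(\<Sum>W | card W = j. card {l \<in> L. l \<inter> W = {}}) = card L * ((card (UNIV :: 'p set) - k) choose j)"
    by simp
  have "card {W :: 'p set. card W = j} = card (UNIV :: 'p set) choose j"
    using n_subsets[of "UNIV :: 'p set" j] by simp
  moreover have "int (card (tor_index L j)) = (\<Sum>W | card (W :: 'p set) = j.
      int j * int r - int (card L) - int j + 1 + int (card {l \<in> L. l \<inter> W = {}}))"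
    unfolding card_tor_index_eq of_nat_sum[of _ "{W. card W = j}"] by (intro sum.cong refl single) simp
  moreover have "\<dots> = (\<Sum>W | card (W :: 'p set) = j. int j * int r - int (card L) - int j + 1)
      + int (\<Sum>W | card W = j. card {l \<in> L. l \<inter> W = {}})"
    by (simp only: sum.distrib of_nat_sum)
  ultimately show ?thesis unfolding missed by (simp add: algebra_simps)
qed

end

section \<open>Projective planes\<close>

lemma projective_plane_nontrivial:
  assumes "projective_plane (UNIV :: 'p::finite set) L"
  shows "2 \<le> card (UNIV :: 'p set)"
proof -
  obtain x y :: 'p where "x \<noteq> y" using assms by (auto simp: projective_plane_def)
  then have "card {x, y} = 2" by simp
  then show ?thesis using card_mono[OF finite subset_UNIV, of "{x, y}"] by simp
qed

lemma projective_plane_order: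
  assumes "projective_plane (UNIV :: 'p::finite set) L" "has_order (UNIV :: 'p set) L q"
  shows "q \<ge> 2"
proof -
  have linear: "linear_space (UNIV :: 'p set) L" using assms(1) by (simp add: projective_plane_def)
  obtain l where "l \<in> L"
    using pair_in_line[OF linear projective_plane_nontrivial[OF assms(1)]] by metis
  moreover have "\<forall>l\<in>L. card l \<ge> 3" using assms(1) by (simp add: projective_plane_def)
  moreover have "\<forall>l\<in>L. card l = q + 1" using assms(2) by (simp add: has_order_def)
  ultimately have "card l \<ge> 3" "card l = q + 1" by blast+
  then show ?thesis by simp
qed

text \<open>Expand \<open>Suc D choose Suc k\<close> by Pascal's rule, after absorbing the factor \<open>Suc k\<close> with
  \<open>Suc k * (Suc D choose Suc k) = Suc D * (D choose k)\<close>.\<close>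

lemma binomial_rearrangement:
  fixes q k :: nat
  defines "D \<equiv> q ^ 2 + q"
  shows "(int (Suc k) * (int q + 1) - int (Suc D) - int (Suc k) + 1) * int (Suc D choose Suc k) =
     int q ^ 3 * int (D choose k) - int q * (int q + 1) * int (D choose Suc k)"
proof -
  define a b where "a = int (D choose k)" and "b = int (D choose Suc k)"
  have sum: "int (Suc D choose Suc k) = a + b" by (simp add: a_def b_def)
  have "int (Suc k) * int (Suc D choose Suc k) = int (Suc D) * int (D choose k)"
    using Suc_times_binomial[of k D] by (metis of_nat_mult)
  then have prod: "int (Suc k) * (a + b) = int (Suc D) * a" unfolding sum a_def .
  have D: "int (Suc D) = int q ^ 2 + int q + 1" "int D = int q ^ 2 + int q"
    by (simp_all add: D_def)
  have "(int (Suc k) * (int q + 1) - int (Suc D) - int (Suc k) + 1) * (a + b) =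
      int q * (int (Suc k) * (a + b)) - int D * (a + b)"
    by (simp add: ring_distribs)
  also have "\<dots> = int q ^ 3 * a - int q * (int q + 1) * b"
    unfolding prod D by (simp add: ring_distribs power2_eq_square power3_eq_cube)
  finally show ?thesis unfolding sum a_def b_def .
qed

theorem corollary2p12:
  fixes L :: "'p::finite set set" and q :: nat
    and I :: "('p, 'k::field) polyring set"
  assumes "projective_plane (UNIV :: 'p set) L"
    and "has_order (UNIV :: 'p set) L q"
    and "I = stanley_reisner_ideal (incidence_complex L)"
  shows "(\<forall>i\<ge>1. betti I i = graded_betti I i (i + 2) \<and>
           int (graded_betti I i (i + 2)) =
             (int q ^ 2 + int q + 1) * int (q ^ 2 choose (i + 2))
             + int q ^ 3 * int ((q ^ 2 + q) choose (i + 1))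
             - int q * (int q + 1) * int ((q ^ 2 + q) choose (i + 2)))
         \<and> betti I (q ^ 2 + q - 1) = q ^ 3"
proof -
  have "linear_space (UNIV :: 'p set) L" using assms(1) by (simp add: projective_plane_def)
  note plane = this projective_plane_nontrivial[OF assms(1)]
  note betti = betti_incidence_complex[where 'k = 'k, OF plane, folded assms(3)]
  have order: "card (UNIV :: 'p set) = q ^ 2 + q + 1" "card L = q ^ 2 + q + 1"
    "\<And>x. card {l \<in> L. x \<in> l} = q + 1" "\<And>l. l \<in> L \<Longrightarrow> card l = q + 1"
    using assms(2) by (auto simp: has_order_def)
  have formula: "int (graded_betti I i (i + 2)) =
      (int q ^ 2 + int q + 1) * int (q ^ 2 choose (i + 2))
      + int q ^ 3 * int ((q ^ 2 + q) choose (i + 1))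
      - int q * (int q + 1) * int ((q ^ 2 + q) choose (i + 2))" if "i \<ge> 1" for i
  proof -
    have "int (graded_betti I i (i + 2)) =
        (int (i + 2) * int (q + 1) - int (q ^ 2 + q + 1) - int (i + 2) + 1) * int ((q ^ 2 + q + 1) choose (i + 2))
        + int (q ^ 2 + q + 1) * int ((q ^ 2 + q + 1 - (q + 1)) choose (i + 2))"
      unfolding betti(2)[OF that] by (subst card_tor_index[OF plane _ order(3,4)]) (simp_all only: order)
    moreover have "i + 2 = Suc (i + 1)" "q ^ 2 + q + 1 = Suc (q ^ 2 + q)" "q ^ 2 + q + 1 - (q + 1) = q ^ 2"
      "int (q + 1) = int q + 1" "int (q ^ 2 + q + 1) = int q ^ 2 + int q + 1" by simp_all
    ultimately show ?thesis
      using binomial_rearrangement[of "i + 1" q] by (simp only:)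
  qed
  have q: "q \<ge> 2" using projective_plane_order[OF assms(1,2)] .
  then have i: "q ^ 2 + q - 1 \<ge> 1" by simp
  have "int (betti I (q ^ 2 + q - 1)) = int (q ^ 3)"
  proof -
    have "q ^ 2 + q - 1 + 2 = q ^ 2 + q + 1" "q ^ 2 + q - 1 + 1 = q ^ 2 + q" using q by auto
    then show ?thesis
      using formula[OF i] betti[OF i] by (simp add: binomial_eq_0)
  qed
  then have "betti I (q ^ 2 + q - 1) = q ^ 3" by (simp only: of_nat_eq_iff)
  then show ?thesis using formula betti by simp
qed

end
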